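(* Let $(S,h,J)$ be a Kähler manifold with a free and proper Hamiltonian action of a Lie group $G$ preserving the Kähler structure, and let $f:S\to S$ be a Hermitian isometry of $(S,h,J)$ which is equivariant with respect to the action of $G$. Let $\mu:S\to\mathfrak{g}^\ast$ be a moment map of the Hamiltonian action of $G$ on $S$, and let $G$ act on the mapping torus $S_f$ by $g\cdot[(p,t)]=[(gp,t)]$. Then the action of $G$ on $S_f$ (with its natural cosymplectic structure) is Hamiltonian if and only if $\mu(f(p))=\mu(p)$ holds for some $p\in S$.
   Context: Kähler moment maps. Let $\Omega(X,Y)=h(X,JY)$ be the symplectic form of $(S,h,J)$. For $A\in\mathfrak{g}$ (Lie algebra of $G$) let $A^\ast$ be the induced vector field. A moment map is a map $\mu:S\to\mathfrak{g}^\ast$, equivariant for the coadjoint action, with $d\mu^A=\Omega(A^\ast,-)$ for all $A\in\mathfrak{g}$, where $\mu^A(p)=(\mu(p))(A)$; the action is Hamiltonian if one exists. A Hermitian isometry is a diffeomorphism $f$ with $f^\ast h=h$ and $f_\ast J=Jf_\ast$. Mapping torus. $S_f=(S\times[0,1])/\{(p,0)\sim(f(p),1)\mid p\in S\}$, equivalently the quotient of $S\times\mathbb{R}$ by the $\mathbb{Z}$-action $k\cdot(p,t)=(f^k(p),t+k)$; $[(p,t)]$ denotes the class of $(p,t)$. Let $\mathrm{pr}:S_f\to S^1=\mathbb{R}/\mathbb{Z}$, $[(p,t)]\mapsto t$, with coordinate $\theta$ on $S^1$. The natural coKähler structure on $S_f$ has $\eta=\mathrm{pr}^\ast d\theta$,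 $\xi_{[(p,t)]}=\frac{d}{ds}|_{s=0}[(p,t+s)]$, $\varphi=\widetilde J$ (extension of $J$ by $0$ on $\frac{\partial}{\partial t}$, descended to $S_f$), $g=\widetilde h+\eta\otimes\eta$, and 2-form $\omega=\widetilde\Omega$, where $\widetilde h,\widetilde\Omega$ are induced on $S_f$ by pulling back $h,\Omega$ to $S\times\mathbb{R}$ and descending. The cosymplectic structure on $S_f$ is $(\eta,\omega)$ (closed forms with $\eta\wedge\omega^n$ nowhere zero, where $\dim S_f=2n+1$), with Reeb vector field $\xi$ ($\omega(\xi,-)=0$, $\eta(\xi)=1$). Cosymplectic moment maps. For a left action of $G$ on a cosymplectic manifold $(N,\eta,\omega)$ preserving $\eta,\omega$, with Reeb vector field $\xi$, a moment map is a smooth equivariant map $\widetilde\mu:N\to\mathfrak{g}^\ast$ (coadjoint action) such that for all $A\in\mathfrak{g}$: $\omega(A^\ast,-)=d\widetilde\mu^A-\xi(\widetilde\mu^A)\eta$, $\eta(A^\ast)=0$, and $d\widetilde\mu^A(\xi)=0$, where $\widetilde\mu^A(x)=(\widetilde\mu(x))(A)$. The action is Hamiltonian if a moment map exists.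
   Formalization: The Kähler manifold S is assumed connected and nonempty; for disconnected S the claim fails, e.g. two copies of ℂ with ℝ acting by x-translations and f the identity on one copy and a y-translation on the other. *)

theory Defs
  imports "HOL-Analysis.Analysis" "HOL-Algebra.Group_Action"
begin

section \<open>Smooth manifolds\<close>

text \<open>
  The model space of a manifold is a type \<open>'e\<close> of class \<open>real_normed_vector\<close> that is required to be
  finite-dimensional in \<open>smooth_manifold\<close>. The class \<open>euclidean_space\<close> is not used because it forces
  positive dimension and would thus exclude points and discrete Lie groups.
\<close>

text \<open>
  \<open>Ck_on k f U\<close> is meant for open \<open>U\<close> in a finite-dimensional space: there, a function all of whose
  directional derivatives are \<open>C\<^sup>k\<close> is \<open>C\<^sup>k\<^sup>+\<^sup>1\<close>.
\<close>

primrec Ck_on :: "nat \<Rightarrow> ('e::real_normed_vector \<Rightarrow> 'f::real_normed_vector) \<Rightarrow> 'e set \<Rightarrow> bool" where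
  "Ck_on 0 f U \<longleftrightarrow> continuous_on U f"
| "Ck_on (Suc k) f U \<longleftrightarrow> (\<forall>x\<in>U. f differentiable at x) \<and>
     (\<forall>v. Ck_on k (\<lambda>x. frechet_derivative f (at x) v) U)"

definition smooth_on :: "'e set \<Rightarrow> ('e::real_normed_vector \<Rightarrow> 'f::real_normed_vector) \<Rightarrow> bool" where
  "smooth_on U f \<longleftrightarrow> (\<forall>k. Ck_on k f U)"

text \<open>A chart is a pair of its domain and its coordinate map; values outside the domain are irrelevant.\<close>

type_synonym ('a, 'e) chart = "'a set \<times> ('a \<Rightarrow> 'e)"

definition chart_inv :: "('a, 'e) chart \<Rightarrow> 'e \<Rightarrow> 'a" where
  "chart_inv c = inv_into (fst c) (snd c)"

record ('a, 'e) manifold =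
  mtop :: "'a topology"
  atlas :: "('a, 'e) chart set"

abbreviation points :: "('a, 'e) manifold \<Rightarrow> 'a set" where
  "points M \<equiv> topspace (mtop M)"

definition is_chart :: "'a topology \<Rightarrow> ('a, 'e::real_normed_vector) chart \<Rightarrow> bool" where
  "is_chart X c \<longleftrightarrow> openin X (fst c) \<and> open (snd c ` fst c) \<and>
     homeomorphic_map (subtopology X (fst c)) (top_of_set (snd c ` fst c)) (snd c)"

definition smooth_transition ::
    "('a, 'e::real_normed_vector) chart \<Rightarrow> ('a, 'e) chart \<Rightarrow> bool" where
  "smooth_transition c d \<longleftrightarrow> smooth_on (snd c ` (fst c \<inter> fst d)) (snd d \<circ> chart_inv c)"

text \<open>The charts of the maximal atlas.\<close>

definition admissible_chart ::
    "('a, 'e::real_normed_vector) manifold \<Rightarrow> ('a, 'e) chart \<Rightarrow> bool" where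
  "admissible_chart M c \<longleftrightarrow> is_chart (mtop M) c \<and>
     (\<forall>d\<in>atlas M. smooth_transition c d \<and> smooth_transition d c)"

definition smooth_manifold :: "('a, 'e::real_normed_vector) manifold \<Rightarrow> bool" where
  "smooth_manifold M \<longleftrightarrow>
     (\<exists>B::'e set. finite B \<and> span B = UNIV) \<and>
     Hausdorff_space (mtop M) \<and> second_countable (mtop M) \<and>
     (\<Union>c\<in>atlas M. fst c) = points M \<and>
     (\<forall>c\<in>atlas M. admissible_chart M c)"

definition smooth_map ::
    "('a, 'e::real_normed_vector) manifold \<Rightarrow> ('b, 'f::real_normed_vector) manifold \<Rightarrow> ('a \<Rightarrow> 'b) \<Rightarrow> bool" where
  "smooth_map M N F \<longleftrightarrow> continuous_map (mtop M) (mtop N) F \<and>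
     (\<forall>c\<in>atlas M. \<forall>d\<in>atlas N.
        smooth_on (snd c ` {p \<in> fst c. F p \<in> fst d}) (snd d \<circ> F \<circ> chart_inv c))"

definition diffeomorphism ::
    "('a, 'e::real_normed_vector) manifold \<Rightarrow> ('b, 'f::real_normed_vector) manifold \<Rightarrow> ('a \<Rightarrow> 'b) \<Rightarrow> bool" where
  "diffeomorphism M N F \<longleftrightarrow> bij_betw F (points M) (points N) \<and> smooth_map M N F \<and>
     smooth_map N M (inv_into (points M) F)"

definition model_manifold :: "('e::real_normed_vector, 'e) manifold" where
  "model_manifold = \<lparr>mtop = euclidean, atlas = {(UNIV, id)}\<rparr>"

definition prod_manifold ::
    "('a, 'e) manifold \<Rightarrow> ('b, 'f) manifold \<Rightarrow> ('a \<times> 'b, 'e \<times> 'f) manifold" where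
  "prod_manifold M N = \<lparr>mtop = prod_topology (mtop M) (mtop N),
     atlas = {(fst c \<times> fst d, map_prod (snd c) (snd d)) |c d. c \<in> atlas M \<and> d \<in> atlas N}\<rparr>"

definition quotient_topology :: "'a topology \<Rightarrow> ('a \<Rightarrow> 'b) \<Rightarrow> 'b topology" where
  "quotient_topology X q =
     topology (\<lambda>V. V \<subseteq> q ` topspace X \<and> openin X {x \<in> topspace X. q x \<in> V})"

lemma openin_quotient_topology:
  "openin (quotient_topology X q) V \<longleftrightarrow>
     V \<subseteq> q ` topspace X \<and> openin X {x \<in> topspace X. q x \<in> V}"
proof -
  let ?P = "\<lambda>V. V \<subseteq> q ` topspace X \<and> openin X {x \<in> topspace X. q x \<in> V}"
  have "istopology ?P"
    unfolding istopology_def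
  proof (intro conjI allI impI)
    fix S T assume S: "?P S" and T: "?P T"
    show "S \<inter> T \<subseteq> q ` topspace X" using S by blast
    have "{x \<in> topspace X. q x \<in> S \<inter> T} = {x \<in> topspace X. q x \<in> S} \<inter> {x \<in> topspace X. q x \<in> T}"
      by blast
    then show "openin X {x \<in> topspace X. q x \<in> S \<inter> T}" using S T by auto
  next
    fix K assume K: "\<forall>S\<in>K. ?P S"
    show "\<Union>K \<subseteq> q ` topspace X" using K by blast
    have "{x \<in> topspace X. q x \<in> \<Union>K} = (\<Union>S\<in>K. {x \<in> topspace X. q x \<in> S})" by blast
    then show "openin X {x \<in> topspace X. q x \<in> \<Union>K}" using K by auto
  qed
  then show ?thesis
    unfolding quotient_topology_def by (simp add: topology_inverse')
qed

text \<open>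
  For a quotient map \<open>q\<close> of a free and properly discontinuous action: the smooth structure making \<open>q\<close>
  a local diffeomorphism. Its charts are those of \<open>M\<close>, restricted to open sets on which \<open>q\<close> is
  injective and transported along \<open>q\<close>.
\<close>

definition quotient_manifold :: "('a, 'e) manifold \<Rightarrow> ('a \<Rightarrow> 'b) \<Rightarrow> ('b, 'e) manifold" where
  "quotient_manifold M q = \<lparr>mtop = quotient_topology (mtop M) q,
     atlas = {(q ` W, snd c \<circ> inv_into W q) |c W.
                c \<in> atlas M \<and> openin (mtop M) W \<and> W \<subseteq> fst c \<and> inj_on q W}\<rparr>"

section \<open>Tangent vectors, differentials and tensors\<close>

text \<open>
  A tangent vector at \<open>p\<close> is its family of coordinate representations in the charts around \<open>p\<close>,
  related by the derivatives of the coordinate changes; the family is \<open>0\<close> at all other charts.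
  Vector space operations are pointwise.
\<close>

type_synonym ('a, 'e) tvec = "('a, 'e) chart \<Rightarrow> 'e"

definition charts_at :: "('a, 'e) manifold \<Rightarrow> 'a \<Rightarrow> ('a, 'e) chart set" where
  "charts_at M p = {c \<in> atlas M. p \<in> fst c}"

definition some_chart :: "('a, 'e) manifold \<Rightarrow> 'a \<Rightarrow> ('a, 'e) chart" where
  "some_chart M p = (SOME c. c \<in> charts_at M p)"

definition tangent_space ::
    "('a, 'e::real_normed_vector) manifold \<Rightarrow> 'a \<Rightarrow> ('a, 'e) tvec set" where
  "tangent_space M p = {v. (\<forall>c. c \<notin> charts_at M p \<longrightarrow> v c = 0) \<and>
     (\<forall>c\<in>charts_at M p. \<forall>d\<in>charts_at M p.
        v d = frechet_derivative (snd d \<circ> chart_inv c) (at (snd c p)) (v c))}"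

definition lincomb ::
    "real \<Rightarrow> ('a, 'e::real_normed_vector) tvec \<Rightarrow> real \<Rightarrow> ('a, 'e) tvec \<Rightarrow> ('a, 'e) tvec" where
  "lincomb r u s v = (\<lambda>c. r *\<^sub>R u c + s *\<^sub>R v c)"

text \<open>The tangent vector at \<open>p\<close> whose representation in the chart \<open>c\<close> is \<open>u\<close>.\<close>

definition coord_vec ::
    "('a, 'e::real_normed_vector) manifold \<Rightarrow> ('a, 'e) chart \<Rightarrow> 'a \<Rightarrow> 'e \<Rightarrow> ('a, 'e) tvec" where
  "coord_vec M c p u = (\<lambda>d. if d \<in> charts_at M p
     then frechet_derivative (snd d \<circ> chart_inv c) (at (snd c p)) u else 0)"

text \<open>The differential at \<open>p\<close> of a vector-valued function; it does not depend on the chart chosen.\<close>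

definition dfun ::
    "('a, 'e::real_normed_vector) manifold \<Rightarrow> ('a \<Rightarrow> 'f::real_normed_vector) \<Rightarrow> 'a \<Rightarrow> ('a, 'e) tvec \<Rightarrow> 'f" where
  "dfun M F p v = (let c = some_chart M p
     in frechet_derivative (F \<circ> chart_inv c) (at (snd c p)) (v c))"

definition tangent_map ::
    "('a, 'e::real_normed_vector) manifold \<Rightarrow> ('b, 'f::real_normed_vector) manifold \<Rightarrow> ('a \<Rightarrow> 'b) \<Rightarrow>
     'a \<Rightarrow> ('a, 'e) tvec \<Rightarrow> ('b, 'f) tvec" where
  "tangent_map M N F p v =
     (\<lambda>d. if d \<in> charts_at N (F p) then dfun M (snd d \<circ> F) p v else 0)"

type_synonym ('a, 'e) one_form = "'a \<Rightarrow> ('a, 'e) tvec \<Rightarrow> real"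
type_synonym ('a, 'e) two_tensor = "'a \<Rightarrow> ('a, 'e) tvec \<Rightarrow> ('a, 'e) tvec \<Rightarrow> real"
type_synonym ('a, 'e) endo_field = "'a \<Rightarrow> ('a, 'e) tvec \<Rightarrow> ('a, 'e) tvec"

definition pullback2 ::
    "('a, 'e::real_normed_vector) manifold \<Rightarrow> ('b, 'f::real_normed_vector) manifold \<Rightarrow> ('a \<Rightarrow> 'b) \<Rightarrow>
     ('b, 'f) two_tensor \<Rightarrow> ('a, 'e) two_tensor" where
  "pullback2 M N F \<tau> p u v = \<tau> (F p) (tangent_map M N F p u) (tangent_map M N F p v)"

text \<open>The tensor on the quotient whose pullback along \<open>q\<close> is \<open>\<tau>\<close>.\<close>

definition descend2 ::
    "('a, 'e::real_normed_vector) manifold \<Rightarrow> ('a \<Rightarrow> 'b) \<Rightarrow> ('a, 'e) two_tensor \<Rightarrow> ('b, 'e) two_tensor" where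
  "descend2 M q \<tau> x X Y = (THE r. \<exists>p\<in>points M. q p = x \<and>
     (\<exists>u\<in>tangent_space M p. \<exists>v\<in>tangent_space M p.
        tangent_map M (quotient_manifold M q) q p u = X \<and>
        tangent_map M (quotient_manifold M q) q p v = Y \<and> r = \<tau> p u v))"

section \<open>Kaehler manifolds\<close>

definition local_rep2 ::
    "('a, 'e::real_normed_vector) manifold \<Rightarrow> ('a, 'e) two_tensor \<Rightarrow> ('a, 'e) chart \<Rightarrow>
     'e \<Rightarrow> 'e \<Rightarrow> 'e \<Rightarrow> real" where
  "local_rep2 M \<tau> c u v x = \<tau> (chart_inv c x)
     (coord_vec M c (chart_inv c x) u) (coord_vec M c (chart_inv c x) v)"

definition riemannian_metric ::
    "('a, 'e::real_normed_vector) manifold \<Rightarrow> ('a, 'e) two_tensor \<Rightarrow> bool" where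
  "riemannian_metric M h \<longleftrightarrow>
     (\<forall>p\<in>points M. \<forall>u\<in>tangent_space M p. \<forall>v\<in>tangent_space M p.
        h p u v = h p v u \<and>
        (\<forall>w\<in>tangent_space M p. \<forall>r s. h p (lincomb r u s v) w = r * h p u w + s * h p v w) \<and>
        (u \<noteq> (\<lambda>_. 0) \<longrightarrow> h p u u > 0)) \<and>
     (\<forall>c\<in>atlas M. \<forall>u v. smooth_on (snd c ` fst c) (local_rep2 M h c u v))"

definition almost_complex ::
    "('a, 'e::real_normed_vector) manifold \<Rightarrow> ('a, 'e) endo_field \<Rightarrow> bool" where
  "almost_complex M J \<longleftrightarrow>
     (\<forall>p\<in>points M. \<forall>u\<in>tangent_space M p.
        J p u \<in> tangent_space M p \<and> J p (J p u) = (\<lambda>c. - u c) \<and>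
        (\<forall>v\<in>tangent_space M p. \<forall>r s. J p (lincomb r u s v) = lincomb r (J p u) s (J p v))) \<and>
     (\<forall>c\<in>atlas M. \<forall>u. smooth_on (snd c ` fst c)
        (\<lambda>x. J (chart_inv c x) (coord_vec M c (chart_inv c x) u) c))"

text \<open>
  \<open>J\<close> comes from a holomorphic atlas: around every point there are coordinates in which it is a
  constant complex structure \<open>J0\<close> of the model space. Linear complex structures are all conjugate, so
  the dependence of \<open>J0\<close> on the point is harmless.
\<close>

definition complex_structure ::
    "('a, 'e::real_normed_vector) manifold \<Rightarrow> ('a, 'e) endo_field \<Rightarrow> bool" where
  "complex_structure M J \<longleftrightarrow> almost_complex M J \<and>
     (\<forall>p\<in>points M. \<exists>c J0. admissible_chart M c \<and> p \<in> fst c \<and> linear J0 \<and>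
        (\<forall>x. J0 (J0 x) = - x) \<and>
        (\<forall>q\<in>fst c. \<forall>v\<in>tangent_space M q. dfun M (snd c) q (J q v) = J0 (dfun M (snd c) q v)))"

text \<open>The coordinate formula for \<open>d\<omega> = 0\<close>, evaluated on constant vector fields.\<close>

definition closed_2form ::
    "('a, 'e::real_normed_vector) manifold \<Rightarrow> ('a, 'e) two_tensor \<Rightarrow> bool" where
  "closed_2form M \<omega> \<longleftrightarrow> (\<forall>c\<in>atlas M. \<forall>x\<in>snd c ` fst c. \<forall>u v w.
     frechet_derivative (local_rep2 M \<omega> c v w) (at x) u -
     frechet_derivative (local_rep2 M \<omega> c u w) (at x) v +
     frechet_derivative (local_rep2 M \<omega> c u v) (at x) w = 0)"

definition fundamental_form ::
    "('a, 'e) two_tensor \<Rightarrow> ('a, 'e) endo_field \<Rightarrow> ('a, 'e) two_tensor" where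
  "fundamental_form h J p u v = h p u (J p v)"

definition kaehler_manifold ::
    "('a, 'e::real_normed_vector) manifold \<Rightarrow> ('a, 'e) two_tensor \<Rightarrow> ('a, 'e) endo_field \<Rightarrow> bool" where
  "kaehler_manifold M h J \<longleftrightarrow> smooth_manifold M \<and> riemannian_metric M h \<and> complex_structure M J \<and>
     (\<forall>p\<in>points M. \<forall>u\<in>tangent_space M p. \<forall>v\<in>tangent_space M p. h p (J p u) (J p v) = h p u v) \<and>
     closed_2form M (fundamental_form h J)"

definition hermitian_isometry ::
    "('a, 'e::real_normed_vector) manifold \<Rightarrow> ('a, 'e) two_tensor \<Rightarrow> ('a, 'e) endo_field \<Rightarrow>
     ('a \<Rightarrow> 'a) \<Rightarrow> bool" where
  "hermitian_isometry M h J f \<longleftrightarrow> diffeomorphism M M f \<and>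
     (\<forall>p\<in>points M. \<forall>u\<in>tangent_space M p. \<forall>v\<in>tangent_space M p. pullback2 M M f h p u v = h p u v) \<and>
     (\<forall>p\<in>points M. \<forall>u\<in>tangent_space M p.
        tangent_map M M f p (J p u) = J (f p) (tangent_map M M f p u))"

section \<open>Lie groups, actions and moment maps\<close>

definition lie_group ::
    "('g, 'm) monoid_scheme \<Rightarrow> ('g, 'l::real_normed_vector) manifold \<Rightarrow> bool" where
  "lie_group G GM \<longleftrightarrow> group G \<and> smooth_manifold GM \<and> points GM = carrier G \<and>
     smooth_map (prod_manifold GM GM) GM (\<lambda>(a, b). a \<otimes>\<^bsub>G\<^esub> b) \<and> smooth_map GM GM (m_inv G)"

definition smooth_action ::
    "('g, 'm) monoid_scheme \<Rightarrow> ('g, 'l::real_normed_vector) manifold \<Rightarrow>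
     ('a, 'e::real_normed_vector) manifold \<Rightarrow> ('g \<Rightarrow> 'a \<Rightarrow> 'a) \<Rightarrow> bool" where
  "smooth_action G GM M \<phi> \<longleftrightarrow> group_action G (points M) \<phi> \<and>
     smooth_map (prod_manifold GM M) M (\<lambda>(g, p). \<phi> g p)"

definition free_action ::
    "('g, 'm) monoid_scheme \<Rightarrow> ('a, 'e) manifold \<Rightarrow> ('g \<Rightarrow> 'a \<Rightarrow> 'a) \<Rightarrow> bool" where
  "free_action G M \<phi> \<longleftrightarrow> (\<forall>g\<in>carrier G. \<forall>p\<in>points M. \<phi> g p = p \<longrightarrow> g = \<one>\<^bsub>G\<^esub>)"

definition proper_action ::
    "('g, 'l) manifold \<Rightarrow> ('a, 'e) manifold \<Rightarrow> ('g \<Rightarrow> 'a \<Rightarrow> 'a) \<Rightarrow> bool" where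
  "proper_action GM M \<phi> \<longleftrightarrow> proper_map (prod_topology (mtop GM) (mtop M))
     (prod_topology (mtop M) (mtop M)) (\<lambda>(g, p). (\<phi> g p, p))"

text \<open>The Lie algebra enters only as a vector space with the adjoint representation.\<close>

definition lie_algebra ::
    "('g, 'm) monoid_scheme \<Rightarrow> ('g, 'l::real_normed_vector) manifold \<Rightarrow> ('g, 'l) tvec set" where
  "lie_algebra G GM = tangent_space GM \<one>\<^bsub>G\<^esub>"

definition lie_algebra_dual ::
    "('g, 'm) monoid_scheme \<Rightarrow> ('g, 'l::real_normed_vector) manifold \<Rightarrow> (('g, 'l) tvec \<Rightarrow> real) set" where
  "lie_algebra_dual G GM = {\<alpha> \<in> extensional (lie_algebra G GM).
     \<forall>A\<in>lie_algebra G GM. \<forall>B\<in>lie_algebra G GM. \<forall>r s.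
       \<alpha> (lincomb r A s B) = r * \<alpha> A + s * \<alpha> B}"

definition Adj ::
    "('g, 'm) monoid_scheme \<Rightarrow> ('g, 'l::real_normed_vector) manifold \<Rightarrow> 'g \<Rightarrow>
     ('g, 'l) tvec \<Rightarrow> ('g, 'l) tvec" where
  "Adj G GM g = tangent_map GM GM (\<lambda>a. g \<otimes>\<^bsub>G\<^esub> a \<otimes>\<^bsub>G\<^esub> inv\<^bsub>G\<^esub> g) \<one>\<^bsub>G\<^esub>"

definition coadj ::
    "('g, 'm) monoid_scheme \<Rightarrow> ('g, 'l::real_normed_vector) manifold \<Rightarrow> 'g \<Rightarrow>
     (('g, 'l) tvec \<Rightarrow> real) \<Rightarrow> (('g, 'l) tvec \<Rightarrow> real)" where
  "coadj G GM g \<alpha> = (\<lambda>A\<in>lie_algebra G GM. \<alpha> (Adj G GM (inv\<^bsub>G\<^esub> g) A))"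

text \<open>
  The induced vector field \<open>A\<^sup>*\<close> at \<open>p\<close>: the differential at the unit of the orbit map \<open>g \<mapsto> g p\<close>,
  applied to \<open>A\<close>, i.e. the velocity of \<open>exp (s A) p\<close> at \<open>s = 0\<close>.
\<close>

definition induced_field ::
    "('g, 'm) monoid_scheme \<Rightarrow> ('g, 'l::real_normed_vector) manifold \<Rightarrow>
     ('a, 'e::real_normed_vector) manifold \<Rightarrow> ('g \<Rightarrow> 'a \<Rightarrow> 'a) \<Rightarrow>
     ('g, 'l) tvec \<Rightarrow> 'a \<Rightarrow> ('a, 'e) tvec" where
  "induced_field G GM M \<phi> A p = tangent_map GM M (\<lambda>g. \<phi> g p) \<one>\<^bsub>G\<^esub> A"

text \<open>
  Smooth equivariant maps into the dual of the Lie algebra. The dual is a finite-dimensional vector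
  space whose linear coordinates are evaluations at vectors \<open>A\<close>, so smoothness is that of all
  \<open>p \<mapsto> \<mu> p A\<close>.
\<close>

definition smooth_equivariant_to_dual ::
    "('g, 'm) monoid_scheme \<Rightarrow> ('g, 'l::real_normed_vector) manifold \<Rightarrow>
     ('a, 'e::real_normed_vector) manifold \<Rightarrow> ('g \<Rightarrow> 'a \<Rightarrow> 'a) \<Rightarrow>
     ('a \<Rightarrow> ('g, 'l) tvec \<Rightarrow> real) \<Rightarrow> bool" where
  "smooth_equivariant_to_dual G GM M \<phi> \<mu> \<longleftrightarrow>
     (\<forall>p\<in>points M. \<mu> p \<in> lie_algebra_dual G GM) \<and>
     (\<forall>A\<in>lie_algebra G GM. smooth_map M model_manifold (\<lambda>p. \<mu> p A)) \<and>
     (\<forall>g\<in>carrier G. \<forall>p\<in>points M. \<mu> (\<phi> g p) = coadj G GM g (\<mu> p))"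

definition moment_map ::
    "('g, 'm) monoid_scheme \<Rightarrow> ('g, 'l::real_normed_vector) manifold \<Rightarrow>
     ('a, 'e::real_normed_vector) manifold \<Rightarrow> ('g \<Rightarrow> 'a \<Rightarrow> 'a) \<Rightarrow> ('a, 'e) two_tensor \<Rightarrow>
     ('a \<Rightarrow> ('g, 'l) tvec \<Rightarrow> real) \<Rightarrow> bool" where
  "moment_map G GM M \<phi> \<Omega> \<mu> \<longleftrightarrow> smooth_equivariant_to_dual G GM M \<phi> \<mu> \<and>
     (\<forall>A\<in>lie_algebra G GM. \<forall>p\<in>points M. \<forall>v\<in>tangent_space M p.
        dfun M (\<lambda>x. \<mu> x A) p v = \<Omega> p (induced_field G GM M \<phi> A p) v)"

definition reeb_field ::
    "('a, 'e::real_normed_vector) manifold \<Rightarrow> ('a, 'e) one_form \<Rightarrow> ('a, 'e) two_tensor \<Rightarrow>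
     'a \<Rightarrow> ('a, 'e) tvec" where
  "reeb_field N \<eta> \<omega> x = (THE v. v \<in> tangent_space N x \<and>
     (\<forall>w\<in>tangent_space N x. \<omega> x v w = 0) \<and> \<eta> x v = 1)"

definition cosymplectic_moment_map ::
    "('g, 'm) monoid_scheme \<Rightarrow> ('g, 'l::real_normed_vector) manifold \<Rightarrow>
     ('a, 'e::real_normed_vector) manifold \<Rightarrow> ('g \<Rightarrow> 'a \<Rightarrow> 'a) \<Rightarrow>
     ('a, 'e) one_form \<Rightarrow> ('a, 'e) two_tensor \<Rightarrow> ('a \<Rightarrow> ('g, 'l) tvec \<Rightarrow> real) \<Rightarrow> bool" where
  "cosymplectic_moment_map G GM N \<phi> \<eta> \<omega> \<mu> \<longleftrightarrow> smooth_equivariant_to_dual G GM N \<phi> \<mu> \<and>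
     (\<forall>A\<in>lie_algebra G GM. \<forall>x\<in>points N.
        (\<forall>v\<in>tangent_space N x. \<omega> x (induced_field G GM N \<phi> A x) v =
           dfun N (\<lambda>y. \<mu> y A) x v - dfun N (\<lambda>y. \<mu> y A) x (reeb_field N \<eta> \<omega> x) * \<eta> x v) \<and>
        \<eta> x (induced_field G GM N \<phi> A x) = 0 \<and>
        dfun N (\<lambda>y. \<mu> y A) x (reeb_field N \<eta> \<omega> x) = 0)"

definition cosymplectic_hamiltonian ::
    "('g, 'm) monoid_scheme \<Rightarrow> ('g, 'l::real_normed_vector) manifold \<Rightarrow>
     ('a, 'e::real_normed_vector) manifold \<Rightarrow> ('g \<Rightarrow> 'a \<Rightarrow> 'a) \<Rightarrow>
     ('a, 'e) one_form \<Rightarrow> ('a, 'e) two_tensor \<Rightarrow> bool" where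
  "cosymplectic_hamiltonian G GM N \<phi> \<eta> \<omega> \<longleftrightarrow> (\<exists>\<mu>. cosymplectic_moment_map G GM N \<phi> \<eta> \<omega> \<mu>)"

section \<open>The mapping torus\<close>

definition int_iterate :: "'a set \<Rightarrow> ('a \<Rightarrow> 'a) \<Rightarrow> int \<Rightarrow> 'a \<Rightarrow> 'a" where
  "int_iterate S f k = (if 0 \<le> k then f ^^ nat k else inv_into S f ^^ nat (- k))"

definition torus_class :: "'a set \<Rightarrow> ('a \<Rightarrow> 'a) \<Rightarrow> 'a \<times> real \<Rightarrow> ('a \<times> real) set" where
  "torus_class S f = (\<lambda>(p, t). {(int_iterate S f k p, t + of_int k) |k. True})"

definition cylinder :: "('a, 'e) manifold \<Rightarrow> ('a \<times> real, 'e \<times> real) manifold" where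
  "cylinder M = prod_manifold M model_manifold"

definition mapping_torus ::
    "('a, 'e::real_normed_vector) manifold \<Rightarrow> ('a \<Rightarrow> 'a) \<Rightarrow> (('a \<times> real) set, 'e \<times> real) manifold" where
  "mapping_torus M f = quotient_manifold (cylinder M) (torus_class (points M) f)"

definition circle :: "(real set, real) manifold" where
  "circle = quotient_manifold model_manifold (\<lambda>t. {t + of_int k |k. True})"

text \<open>\<open>d\<theta>\<close>: the charts of \<open>circle\<close> are local lifts of \<open>\<theta>\<close> to the real line, so any two of them
  locally differ by a constant.\<close>

definition circle_dtheta :: "(real set, real) one_form" where
  "circle_dtheta x v = v (some_chart circle x)"

text \<open>Taking second components turns the class of \<open>(p, t)\<close> into the class of \<open>t\<close> modulo the integers.\<close>

definition torus_proj :: "('a \<times> real) set \<Rightarrow> real set" where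
  "torus_proj x = snd ` x"

definition torus_eta ::
    "('a, 'e::real_normed_vector) manifold \<Rightarrow> ('a \<Rightarrow> 'a) \<Rightarrow> (('a \<times> real) set, 'e \<times> real) one_form" where
  "torus_eta M f x v = circle_dtheta (torus_proj x)
     (tangent_map (mapping_torus M f) circle torus_proj x v)"

definition torus_omega ::
    "('a, 'e::real_normed_vector) manifold \<Rightarrow> ('a \<Rightarrow> 'a) \<Rightarrow> ('a, 'e) two_tensor \<Rightarrow>
     (('a \<times> real) set, 'e \<times> real) two_tensor" where
  "torus_omega M f \<Omega> =
     descend2 (cylinder M) (torus_class (points M) f) (pullback2 (cylinder M) M fst \<Omega>)"

text \<open>If \<open>g\<close> commutes with \<open>f\<close>, this maps the class of \<open>(p, t)\<close> to the class of \<open>(g p, t)\<close>.\<close>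

definition torus_action ::
    "('a, 'e::real_normed_vector) manifold \<Rightarrow> ('a \<Rightarrow> 'a) \<Rightarrow> ('g \<Rightarrow> 'a \<Rightarrow> 'a) \<Rightarrow>
     'g \<Rightarrow> ('a \<times> real) set \<Rightarrow> ('a \<times> real) set" where
  "torus_action M f \<phi> g = (\<lambda>x\<in>points (mapping_torus M f). (\<lambda>(p, t). (\<phi> g p, t)) ` x)"

end

theory Submission
  imports Defs
begin

text \<open>
  Let \<open>q\<close> be the quotient map from \<open>S \<times> \<real>\<close> to the mapping torus. It identifies tangent spaces, and
  under this identification \<open>\<omega>\<close> is the pullback of \<open>\<Omega>\<close>, \<open>\<eta>\<close> is \<open>dt\<close>, the Reeb field is \<open>\<partial>/\<partial>t\<close> and the
  field induced by \<open>A\<close> is the one on \<open>S\<close>, tangent to the slices \<open>S \<times> {t}\<close> (\<open>torus_omega_q\<close>,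
  \<open>torus_eta_q\<close>, \<open>reeb_field_torus\<close>, \<open>induced_field_torus\<close>).

  Suppose that \<open>\<nu>\<close> is a cosymplectic moment map. The condition on the Reeb field says that \<open>\<nu> \<circ> q\<close> does
  not depend on \<open>t\<close> (\<open>moment_map_constant_vertically\<close>), and the condition on \<open>\<omega>\<close> says that on each slice
  \<open>\<nu> \<circ> q\<close> solves the same equation as \<open>\<mu>\<close> (\<open>moment_map_horizontal_derivative\<close>). As \<open>S\<close> is connected,
  \<open>\<nu> \<circ> q\<close> and \<open>\<mu>\<close> differ by a constant (\<open>equal_dfun_imp_constant_difference\<close>). Now \<open>q (p, 0) = q (f p, 1)\<close>
  makes \<open>\<nu> \<circ> q\<close>, and with it \<open>\<mu>\<close>, invariant under \<open>f\<close>.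

  Conversely, \<open>f\<close> preserves \<open>\<Omega>\<close> and, being equivariant, the induced fields, so \<open>\<mu> \<circ> f\<close> and \<open>\<mu>\<close> have
  equal differentials. If they agree at one point they agree everywhere, and then \<open>(p, t) \<mapsto> \<mu> p\<close>
  descends to a moment map of the mapping torus (\<open>cosymplectic_moment_map_of_invariant\<close>).

  The geometry above is of first order: tangent spaces, differentials and the chain rule. It is
  developed for manifolds whose charts have differentiable transitions, a class that contains smooth
  manifolds and is closed under products and under quotients by deck transformations; this covers
  \<open>S \<times> \<real>\<close>, the circle and the mapping torus.
\<close>

section \<open>Calculus in normed spaces\<close>

lemma differentiable_cong_nhds:
  assumes "\<forall>\<^sub>F y in nhds x. f y = g y" and "f differentiable at x"
  shows "g differentiable at x" and "frechet_derivative g (at x) = frechet_derivative f (at x)"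
proof -
  obtain S where S: "open S" "x \<in> S" "\<And>y. y \<in> S \<Longrightarrow> f y = g y"
    using assms(1) unfolding eventually_nhds by blast
  have "(f has_derivative frechet_derivative f (at x)) (at x)"
    using assms(2) frechet_derivative_works by blast
  then have g: "(g has_derivative frechet_derivative f (at x)) (at x)"
    using has_derivative_transform_within_open S by blast
  then show "g differentiable at x" by (auto simp: differentiable_def)
  from g show "frechet_derivative g (at x) = frechet_derivative f (at x)"
    using frechet_derivative_at by metis
qed

lemma frechet_derivative_chain:
  assumes "g differentiable at x" and "f differentiable at (g x)"
  shows "(f \<circ> g) differentiable at x"
    and "frechet_derivative (f \<circ> g) (at x) v =
      frechet_derivative f (at (g x)) (frechet_derivative g (at x) v)"
  using assms by (simp_all add: differentiable_chain_at frechet_derivative_compose)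

lemma frechet_derivative_fst: "frechet_derivative fst (at x) = fst"
  by (rule frechet_derivative_at[symmetric]) (rule has_derivative_fst[OF has_derivative_ident])

lemma differentiable_fst_at: "fst differentiable at x"
  using has_derivative_fst[OF has_derivative_ident] by (auto simp: differentiable_def)

lemma frechet_derivative_snd: "frechet_derivative snd (at x) = snd"
  by (rule frechet_derivative_at[symmetric]) (rule has_derivative_snd[OF has_derivative_ident])

lemma differentiable_snd_at: "snd differentiable at x"
  using has_derivative_snd[OF has_derivative_ident] by (auto simp: differentiable_def)

lemma smooth_on_imp_differentiable:
  assumes "smooth_on U f" and "x \<in> U"
  shows "f differentiable at x"
  using assms Ck_on.simps(2)[of 0 f U] unfolding smooth_on_def by blast

lemma Ck_on_cong:
  assumes "open U" and "\<And>x. x \<in> U \<Longrightarrow> f x = g x" and "Ck_on k f U"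
  shows "Ck_on k g U"
  using assms(2,3)
proof (induction k arbitrary: f g)
  case 0
  then show ?case by (simp cong: continuous_on_cong)
next
  case (Suc k)
  have ev: "\<forall>\<^sub>F y in nhds x. f y = g y" if "x \<in> U" for x
    using assms(1) Suc.prems(1) that unfolding eventually_nhds by blast
  have f: "f differentiable at x" if "x \<in> U" for x
    using Suc.prems(2) that by simp
  have "Ck_on k (\<lambda>x. frechet_derivative g (at x) v) U" for v
  proof (rule Suc.IH)
    show "frechet_derivative f (at x) v = frechet_derivative g (at x) v" if "x \<in> U" for x
      using differentiable_cong_nhds(2)[OF ev f] that by simp
    show "Ck_on k (\<lambda>x. frechet_derivative f (at x) v) U"
      using Suc.prems(2) by simp
  qed
  then show ?case
    using differentiable_cong_nhds(1)[OF ev f] by simp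
qed

text \<open>The derivative of \<open>f \<circ> fst\<close> in direction \<open>v\<close> is the derivative of \<open>f\<close> in direction \<open>fst v\<close>,
  again composed with \<open>fst\<close>. This gives the smoothness of functions on the mapping torus that come
  from functions on \<open>S\<close>.\<close>

lemma Ck_on_comp_fst:
  assumes "Ck_on k f U" and "open W" and "fst ` W \<subseteq> U"
  shows "Ck_on k (f \<circ> fst) W"
  using assms(1)
proof (induction k arbitrary: f)
  case 0
  then show ?case
    using assms(3) continuous_on_compose2[of U f W fst] continuous_on_fst[of W "\<lambda>x. x"]
    by (simp add: comp_def)
next
  case (Suc k)
  have f: "f differentiable at (fst x)" if "x \<in> W" for x
    using Suc.prems assms(3) that by auto
  have "Ck_on k (\<lambda>x. frechet_derivative (f \<circ> fst) (at x) v) W" for v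
  proof (rule Ck_on_cong[OF assms(2)])
    show "Ck_on k ((\<lambda>y. frechet_derivative f (at y) (fst v)) \<circ> fst) W"
      by (rule Suc.IH) (use Suc.prems in simp)
    show "((\<lambda>y. frechet_derivative f (at y) (fst v)) \<circ> fst) x =
        frechet_derivative (f \<circ> fst) (at x) v" if "x \<in> W" for x
      using frechet_derivative_chain(2)[OF differentiable_fst_at f[OF that]]
      by (simp add: frechet_derivative_fst)
  qed
  moreover have "(f \<circ> fst) differentiable at x" if "x \<in> W" for x
    using frechet_derivative_chain(1)[OF differentiable_fst_at f[OF that]] .
  ultimately show ?case unfolding Ck_on.simps by blast
qed

section \<open>Differentiable atlases\<close>

text \<open>The part of a smooth structure on which first-order calculus rests. That charts are open maps turns
  neighbourhoods in the manifold into neighbourhoods in the model space, where derivatives are taken.\<close>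

definition differentiable_atlas :: "('a, 'e::real_normed_vector) manifold \<Rightarrow> bool" where
  "differentiable_atlas M \<longleftrightarrow> (\<Union>c\<in>atlas M. fst c) = points M \<and>
     (\<forall>c\<in>atlas M. openin (mtop M) (fst c) \<and> inj_on (snd c) (fst c) \<and>
        (\<forall>U. openin (mtop M) U \<longrightarrow> U \<subseteq> fst c \<longrightarrow> open (snd c ` U))) \<and>
     (\<forall>c\<in>atlas M. \<forall>d\<in>atlas M. \<forall>p\<in>fst c \<inter> fst d.
        (snd d \<circ> chart_inv c) differentiable (at (snd c p)))"

lemma chart_inv_inverse:
  "inj_on (snd c) (fst c) \<Longrightarrow> p \<in> fst c \<Longrightarrow> chart_inv c (snd c p) = p"
  by (simp add: chart_inv_def)

lemma smooth_manifold_differentiable_atlas: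
  assumes "smooth_manifold M"
  shows "differentiable_atlas M"
  unfolding differentiable_atlas_def
proof (intro conjI ballI allI impI)
  show "(\<Union>c\<in>atlas M. fst c) = points M"
    using assms by (simp add: smooth_manifold_def)
next
  fix c assume "c \<in> atlas M"
  then have c: "is_chart (mtop M) c"
    using assms by (simp add: smooth_manifold_def admissible_chart_def)
  then show o: "openin (mtop M) (fst c)" by (simp add: is_chart_def)
  have h: "homeomorphic_map (subtopology (mtop M) (fst c)) (top_of_set (snd c ` fst c)) (snd c)"
    using c by (simp add: is_chart_def)
  have ts: "topspace (subtopology (mtop M) (fst c)) = fst c"
    using openin_subset[OF o] by auto
  show "inj_on (snd c) (fst c)"
    using h ts unfolding homeomorphic_map_def by (metis homeomorphic_imp_injective_map h)
  fix U assume U: "openin (mtop M) U" "U \<subseteq> fst c"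
  then have "openin (subtopology (mtop M) (fst c)) U"
    by (simp add: openin_subset_topspace_eq openin_subtopology_alt ts)
       (metis U inf.absorb_iff2 image_eqI mem_Collect_eq)
  then have "openin (top_of_set (snd c ` fst c)) (snd c ` U)"
    using homeomorphic_imp_open_map[OF h] by (simp add: open_map_def)
  then show "open (snd c ` U)"
    using c openin_open_trans by (auto simp: is_chart_def)
next
  fix c d p assume "c \<in> atlas M" "d \<in> atlas M" "p \<in> fst c \<inter> fst d"
  then show "(snd d \<circ> chart_inv c) differentiable (at (snd c p))"
    using assms by (auto simp: smooth_manifold_def admissible_chart_def smooth_transition_def
        intro!: smooth_on_imp_differentiable)
qed

lemma charts_at_nonempty:
  assumes "differentiable_atlas M" and "p \<in> points M"
  obtains c where "c \<in> charts_at M p"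
  using assms unfolding differentiable_atlas_def charts_at_def by blast

lemma some_chart_in_charts_at:
  assumes "differentiable_atlas M" and "p \<in> points M"
  shows "some_chart M p \<in> charts_at M p"
  using charts_at_nonempty[OF assms] unfolding some_chart_def by (metis someI_ex)

lemma charts_at_in_points:
  assumes "differentiable_atlas M" and "c \<in> charts_at M p"
  shows "p \<in> points M"
  using assms by (auto simp: differentiable_atlas_def charts_at_def)

lemma chart_inv_at:
  assumes "differentiable_atlas M" and "c \<in> charts_at M p"
  shows "chart_inv c (snd c p) = p"
  using assms by (auto simp: differentiable_atlas_def charts_at_def intro: chart_inv_inverse)

lemma transition_differentiable:
  assumes "differentiable_atlas M" and "c \<in> charts_at M p" and "d \<in> charts_at M p"
  shows "(snd d \<circ> chart_inv c) differentiable (at (snd c p))"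
  using assms by (auto simp: differentiable_atlas_def charts_at_def)

text \<open>Two expressions in coordinates that agree on a neighbourhood of \<open>p\<close> in the manifold thus agree near
  \<open>snd c p\<close>, where they have the same derivative.\<close>

lemma eventually_chart_inv:
  assumes "differentiable_atlas M" and "c \<in> charts_at M p" and "openin (mtop M) U" and "p \<in> U"
  shows "\<forall>\<^sub>F y in nhds (snd c p). chart_inv c y \<in> U \<inter> fst c \<and> snd c (chart_inv c y) = y"
proof -
  have c: "openin (mtop M) (fst c)" "inj_on (snd c) (fst c)" "p \<in> fst c"
    "\<And>U. openin (mtop M) U \<Longrightarrow> U \<subseteq> fst c \<Longrightarrow> open (snd c ` U)"
    using assms(1,2) by (auto simp: differentiable_atlas_def charts_at_def)
  have "open (snd c ` (U \<inter> fst c))"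
    using c(1,4) assms(3) by (meson openin_Int Int_lower2)
  moreover have "snd c p \<in> snd c ` (U \<inter> fst c)" using c(3) assms(4) by blast
  moreover have "chart_inv c y \<in> U \<inter> fst c \<and> snd c (chart_inv c y) = y"
    if y: "y \<in> snd c ` (U \<inter> fst c)" for y
    using y chart_inv_inverse[OF c(2)] by auto
  ultimately show ?thesis unfolding eventually_nhds by blast
qed

text \<open>Near \<open>snd c p\<close> the coordinate expression of \<open>F\<close> in \<open>c\<close> is the one in \<open>d\<close> after the coordinate change.\<close>

lemma change_of_chart:
  fixes F :: "'a \<Rightarrow> 'f::real_normed_vector"
  assumes M: "differentiable_atlas M" and c: "c \<in> charts_at M p" and d: "d \<in> charts_at M p"
    and F: "(F \<circ> chart_inv d) differentiable (at (snd d p))"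
  shows "(F \<circ> chart_inv c) differentiable (at (snd c p))"
    and "frechet_derivative (F \<circ> chart_inv c) (at (snd c p)) v =
      frechet_derivative (F \<circ> chart_inv d) (at (snd d p))
        (frechet_derivative (snd d \<circ> chart_inv c) (at (snd c p)) v)"
proof -
  let ?T = "snd d \<circ> chart_inv c"
  have T: "?T differentiable (at (snd c p))"
    using transition_differentiable M c d .
  have Tp: "?T (snd c p) = snd d p" using chart_inv_at[OF M c] by simp
  have d': "openin (mtop M) (fst d)" "p \<in> fst d" "inj_on (snd d) (fst d)"
    using M d by (auto simp: differentiable_atlas_def charts_at_def)
  have ev: "\<forall>\<^sub>F y in nhds (snd c p). ((F \<circ> chart_inv d) \<circ> ?T) y = (F \<circ> chart_inv c) y"
    using eventually_chart_inv[OF M c d'(1,2)]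
    by eventually_elim (simp add: chart_inv_inverse[OF d'(3)])
  have F': "(F \<circ> chart_inv d) differentiable (at (?T (snd c p)))" using F Tp by simp
  note ch = frechet_derivative_chain[OF T F']
  show "(F \<circ> chart_inv c) differentiable (at (snd c p))"
    by (rule differentiable_cong_nhds(1)[OF ev ch(1)])
  show "frechet_derivative (F \<circ> chart_inv c) (at (snd c p)) v =
      frechet_derivative (F \<circ> chart_inv d) (at (snd d p)) (frechet_derivative ?T (at (snd c p)) v)"
    using differentiable_cong_nhds(2)[OF ev ch(1)] ch(2)[of v] by (simp only: Tp)
qed

section \<open>Tangent vectors\<close>

lemma tangent_spaceD:
  assumes "v \<in> tangent_space M p" and "c \<in> charts_at M p" and "d \<in> charts_at M p"
  shows "v d = frechet_derivative (snd d \<circ> chart_inv c) (at (snd c p)) (v c)"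
  using assms unfolding tangent_space_def by blast

lemma tangent_space_outside:
  assumes "v \<in> tangent_space M p" and "d \<notin> charts_at M p"
  shows "v d = 0"
  using assms unfolding tangent_space_def by blast

lemma tangent_vec_eqI:
  assumes "u \<in> tangent_space M p" and "v \<in> tangent_space M p"
    and "c \<in> charts_at M p" and "u c = v c"
  shows "u = v"
proof
  fix d
  show "u d = v d"
  proof (cases "d \<in> charts_at M p")
    case True
    then show ?thesis using tangent_spaceD[OF _ assms(3) True] assms(1,2,4) by metis
  next
    case False
    then show ?thesis using tangent_space_outside assms(1,2) by metis
  qed
qed

lemma transition_derivative_self:
  assumes "differentiable_atlas M" and "c \<in> charts_at M p"
  shows "frechet_derivative (snd c \<circ> chart_inv c) (at (snd c p)) = (\<lambda>v. v)"
proof -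
  have "\<forall>\<^sub>F y in nhds (snd c p). y = (snd c \<circ> chart_inv c) y"
    using eventually_chart_inv[OF assms openin_topspace charts_at_in_points[OF assms]]
    by eventually_elim simp
  then have "frechet_derivative (snd c \<circ> chart_inv c) (at (snd c p)) =
      frechet_derivative (\<lambda>y. y) (at (snd c p))"
    by (rule differentiable_cong_nhds(2)) simp
  then show ?thesis by simp
qed

lemma coord_vec_in_tangent_space:
  assumes "differentiable_atlas M" and "c \<in> charts_at M p"
  shows "coord_vec M c p u \<in> tangent_space M p" and "coord_vec M c p u c = u"
proof -
  have "coord_vec M c p u e =
      frechet_derivative (snd e \<circ> chart_inv d) (at (snd d p)) (coord_vec M c p u d)"
    if d: "d \<in> charts_at M p" and e: "e \<in> charts_at M p" for d e
    using change_of_chart(2)[OF assms d transition_differentiable[OF assms(1) d e]] d e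
    by (simp only: coord_vec_def if_True)
  moreover have "coord_vec M c p u d = 0" if "d \<notin> charts_at M p" for d
    using that by (simp add: coord_vec_def)
  ultimately show "coord_vec M c p u \<in> tangent_space M p"
    unfolding tangent_space_def by blast
  show "coord_vec M c p u c = u"
    using assms(2) transition_derivative_self[OF assms] by (simp add: coord_vec_def)
qed

section \<open>Differentiable functions and maps\<close>

definition differentiable_fun ::
    "('a, 'e::real_normed_vector) manifold \<Rightarrow> ('a \<Rightarrow> 'f::real_normed_vector) \<Rightarrow> 'a \<Rightarrow> bool" where
  "differentiable_fun M F p \<longleftrightarrow> p \<in> points M \<and>
     (\<forall>c\<in>charts_at M p. (F \<circ> chart_inv c) differentiable (at (snd c p)))"

text \<open>Continuity at \<open>p\<close> is part of the definition: without it, charts around \<open>F p\<close> would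
  say nothing about \<open>F\<close> near \<open>p\<close>.\<close>

definition differentiable_map ::
    "('a, 'e::real_normed_vector) manifold \<Rightarrow> ('b, 'f::real_normed_vector) manifold \<Rightarrow> ('a \<Rightarrow> 'b) \<Rightarrow>
     'a \<Rightarrow> bool" where
  "differentiable_map M N F p \<longleftrightarrow> p \<in> points M \<and> F p \<in> points N \<and>
     (\<forall>V. openin (mtop N) V \<longrightarrow> F p \<in> V \<longrightarrow> (\<exists>U. openin (mtop M) U \<and> p \<in> U \<and> F ` U \<subseteq> V)) \<and>
     (\<forall>d\<in>charts_at N (F p). differentiable_fun M (snd d \<circ> F) p)"

lemma differentiable_funI:
  assumes "differentiable_atlas M" and "c \<in> charts_at M p"
    and "(F \<circ> chart_inv c) differentiable (at (snd c p))"
  shows "differentiable_fun M F p"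
  unfolding differentiable_fun_def
  using charts_at_in_points[OF assms(1,2)] change_of_chart(1)[OF assms(1) _ assms(2,3)] by blast

lemma dfun_in_chart:
  assumes M: "differentiable_atlas M" and F: "differentiable_fun M F p"
    and v: "v \<in> tangent_space M p" and c: "c \<in> charts_at M p"
  shows "dfun M F p v = frechet_derivative (F \<circ> chart_inv c) (at (snd c p)) (v c)"
proof -
  let ?s = "some_chart M p"
  have s: "?s \<in> charts_at M p" using M F some_chart_in_charts_at by (auto simp: differentiable_fun_def)
  have "frechet_derivative (F \<circ> chart_inv ?s) (at (snd ?s p)) (v ?s) =
    frechet_derivative (F \<circ> chart_inv c) (at (snd c p))
      (frechet_derivative (snd c \<circ> chart_inv ?s) (at (snd ?s p)) (v ?s))"
    by (rule change_of_chart(2)[OF M s c]) (use F c in \<open>simp add: differentiable_fun_def\<close>)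
  then show ?thesis
    using tangent_spaceD[OF v s c] by (simp add: dfun_def Let_def)
qed

lemma differentiable_fun_cong:
  assumes M: "differentiable_atlas M" and F: "differentiable_fun M F p"
    and U: "openin (mtop M) U" "p \<in> U" and eq: "\<And>x. x \<in> U \<Longrightarrow> F x = H x"
  shows "differentiable_fun M H p" and "dfun M H p = dfun M F p"
proof -
  have ev: "\<forall>\<^sub>F y in nhds (snd c p). (F \<circ> chart_inv c) y = (H \<circ> chart_inv c) y"
    if "c \<in> charts_at M p" for c
    using eventually_chart_inv[OF M that U] by eventually_elim (simp add: eq)
  have Fc: "(F \<circ> chart_inv c) differentiable (at (snd c p))" if "c \<in> charts_at M p" for c
    using F that by (simp add: differentiable_fun_def)
  have "(H \<circ> chart_inv c) differentiable (at (snd c p))" if "c \<in> charts_at M p" for c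
    by (rule differentiable_cong_nhds(1)[OF ev Fc]) (use that in simp_all)
  then show "differentiable_fun M H p"
    using F by (simp add: differentiable_fun_def)
  have s: "some_chart M p \<in> charts_at M p"
    using M F some_chart_in_charts_at by (auto simp: differentiable_fun_def)
  have "frechet_derivative (H \<circ> chart_inv (some_chart M p)) (at (snd (some_chart M p) p)) =
      frechet_derivative (F \<circ> chart_inv (some_chart M p)) (at (snd (some_chart M p) p))"
    by (rule differentiable_cong_nhds(2)[OF ev[OF s] Fc[OF s]])
  then show "dfun M H p = dfun M F p"
    by (simp add: dfun_def fun_eq_iff)
qed

lemma differentiable_map_cong:
  assumes M: "differentiable_atlas M" and F: "differentiable_map M N F p"
    and U: "openin (mtop M) U" "p \<in> U" and eq: "\<And>x. x \<in> U \<Longrightarrow> F x = H x"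
  shows "differentiable_map M N H p" and "tangent_map M N H p = tangent_map M N F p"
proof -
  have p: "H p = F p" using U(2) eq by simp
  have d: "differentiable_fun M (snd d \<circ> F) p" if "d \<in> charts_at N (F p)" for d
    using F that by (simp add: differentiable_map_def)
  have e: "(snd d \<circ> F) x = (snd d \<circ> H) x" if "x \<in> U" for x d
    using eq that by simp
  note c = differentiable_fun_cong[OF M d U e]
  have "\<exists>U. openin (mtop M) U \<and> p \<in> U \<and> H ` U \<subseteq> V" if V: "openin (mtop N) V" "H p \<in> V" for V
  proof -
    obtain U' where U': "openin (mtop M) U'" "p \<in> U'" "F ` U' \<subseteq> V"
      using F V p unfolding differentiable_map_def by metis
    have "openin (mtop M) (U \<inter> U')" "p \<in> U \<inter> U'" "H ` (U \<inter> U') \<subseteq> V"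
      using U U' eq by (auto simp: image_subset_iff)
    then show ?thesis by blast
  qed
  moreover have "differentiable_fun M (snd d \<circ> H) p" if "d \<in> charts_at N (F p)" for d
    by (rule c(1)) (use that in simp_all)
  ultimately show "differentiable_map M N H p"
    using F p by (simp add: differentiable_map_def)
  have "dfun M (snd d \<circ> H) p = dfun M (snd d \<circ> F) p" if "d \<in> charts_at N (F p)" for d
    by (rule c(2)) (use that in simp_all)
  then show "tangent_map M N H p = tangent_map M N F p"
    using p by (intro ext) (simp add: tangent_map_def)
qed

text \<open>
  The chain rule, with the intermediate point seen in a chart \<open>d\<close>. Here \<open>v\<close> is any family of vectors,
  because \<open>dfun M\<close> reads it in a single chart.
\<close>

lemma dfun_comp_in_chart:
  assumes M: "differentiable_atlas M" and N: "differentiable_atlas N"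
    and F: "differentiable_map M N F p" and H: "differentiable_fun N H (F p)"
    and d: "d \<in> charts_at N (F p)"
  shows "differentiable_fun M (H \<circ> F) p"
    and "dfun M (H \<circ> F) p v =
      frechet_derivative (H \<circ> chart_inv d) (at (snd d (F p))) (dfun M (snd d \<circ> F) p v)"
proof -
  have p: "p \<in> points M" using F by (simp add: differentiable_map_def)
  define c where "c = some_chart M p"
  have c: "c \<in> charts_at M p" using some_chart_in_charts_at[OF M p] by (simp add: c_def)
  have dd: "openin (mtop N) (fst d)" "F p \<in> fst d" "inj_on (snd d) (fst d)"
    using N d by (auto simp: differentiable_atlas_def charts_at_def)
  obtain U where U: "openin (mtop M) U" "p \<in> U" "F ` U \<subseteq> fst d"
    using F dd unfolding differentiable_map_def by metis
  let ?G = "(snd d \<circ> F) \<circ> chart_inv c"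
  have G: "?G differentiable (at (snd c p))"
    using F d c by (simp add: differentiable_map_def differentiable_fun_def)
  have Gp: "?G (snd c p) = snd d (F p)" using chart_inv_at[OF M c] by simp
  have H': "(H \<circ> chart_inv d) differentiable (at (?G (snd c p)))"
    using H d Gp by (simp add: differentiable_fun_def)
  have ev: "\<forall>\<^sub>F y in nhds (snd c p). ((H \<circ> chart_inv d) \<circ> ?G) y = ((H \<circ> F) \<circ> chart_inv c) y"
    using eventually_chart_inv[OF M c U(1,2)]
    by eventually_elim (use U(3) in \<open>auto simp: chart_inv_inverse[OF dd(3)]\<close>)
  note ch = frechet_derivative_chain[OF G H']
  show "differentiable_fun M (H \<circ> F) p"
    by (rule differentiable_funI[OF M c differentiable_cong_nhds(1)[OF ev ch(1)]])
  have "frechet_derivative (H \<circ> F \<circ> chart_inv c) (at (snd c p)) (v c) =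
      frechet_derivative (H \<circ> chart_inv d) (at (snd d (F p))) (frechet_derivative ?G (at (snd c p)) (v c))"
    using differentiable_cong_nhds(2)[OF ev ch(1)] ch(2)[of "v c"] by (simp only: Gp)
  then show "dfun M (H \<circ> F) p v =
      frechet_derivative (H \<circ> chart_inv d) (at (snd d (F p))) (dfun M (snd d \<circ> F) p v)"
    by (simp only: dfun_def Let_def c_def)
qed

lemma differentiable_fun_chart:
  assumes "differentiable_atlas M" and "d \<in> charts_at M p"
  shows "differentiable_fun M (snd d) p"
  using charts_at_in_points[OF assms] transition_differentiable[OF assms(1) _ assms(2)]
  unfolding differentiable_fun_def by blast

lemma tangent_map_in_tangent_space:
  assumes M: "differentiable_atlas M" and N: "differentiable_atlas N"
    and F: "differentiable_map M N F p"
  shows "tangent_map M N F p v \<in> tangent_space N (F p)"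
proof -
  have "tangent_map M N F p v e =
      frechet_derivative (snd e \<circ> chart_inv d) (at (snd d (F p))) (tangent_map M N F p v d)"
    if d: "d \<in> charts_at N (F p)" and e: "e \<in> charts_at N (F p)" for d e
    using dfun_comp_in_chart(2)[OF M N F differentiable_fun_chart[OF N e] d] d e
    unfolding tangent_map_def by (simp only: if_True)
  moreover have "tangent_map M N F p v d = 0" if "d \<notin> charts_at N (F p)" for d
    using that by (simp add: tangent_map_def)
  ultimately show ?thesis unfolding tangent_space_def by blast
qed

lemma dfun_comp:
  assumes M: "differentiable_atlas M" and N: "differentiable_atlas N"
    and F: "differentiable_map M N F p" and H: "differentiable_fun N H (F p)"
  shows "differentiable_fun M (H \<circ> F) p"
    and "dfun M (H \<circ> F) p v = dfun N H (F p) (tangent_map M N F p v)"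
proof -
  have "F p \<in> points N" using F by (simp add: differentiable_map_def)
  then have d: "some_chart N (F p) \<in> charts_at N (F p)" using some_chart_in_charts_at[OF N] by blast
  show "differentiable_fun M (H \<circ> F) p" using dfun_comp_in_chart(1)[OF assms d] .
  show "dfun M (H \<circ> F) p v = dfun N H (F p) (tangent_map M N F p v)"
    using dfun_comp_in_chart(2)[OF assms d] dfun_in_chart[OF N H tangent_map_in_tangent_space[OF M N F] d] d
    by (simp add: tangent_map_def)
qed

lemma tangent_map_comp:
  assumes M: "differentiable_atlas M" and N: "differentiable_atlas N"
    and F: "differentiable_map M N F p" and H: "differentiable_map N P H (F p)"
  shows "differentiable_map M P (H \<circ> F) p"
    and "tangent_map M P (H \<circ> F) p v = tangent_map N P H (F p) (tangent_map M N F p v)"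
proof -
  have d: "differentiable_fun N (snd d \<circ> H) (F p)" if "d \<in> charts_at P (H (F p))" for d
    using H that by (simp add: differentiable_map_def)
  note c = dfun_comp[OF M N F d]
  have "\<exists>U. openin (mtop M) U \<and> p \<in> U \<and> (H \<circ> F) ` U \<subseteq> V" if V: "openin (mtop P) V" "H (F p) \<in> V" for V
  proof -
    obtain W where W: "openin (mtop N) W" "F p \<in> W" "H ` W \<subseteq> V"
      using H V unfolding differentiable_map_def by metis
    obtain U where "openin (mtop M) U" "p \<in> U" "F ` U \<subseteq> W"
      using F W unfolding differentiable_map_def by metis
    then show ?thesis using W(3) by fastforce
  qed
  moreover have "differentiable_fun M (snd d \<circ> (H \<circ> F)) p" if "d \<in> charts_at P (H (F p))" for d
    using c(1)[OF that] by (simp only: o_assoc)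
  ultimately show "differentiable_map M P (H \<circ> F) p"
    using F H by (simp add: differentiable_map_def)
  have "dfun M (snd d \<circ> (H \<circ> F)) p v = dfun N (snd d \<circ> H) (F p) (tangent_map M N F p v)"
    if "d \<in> charts_at P (H (F p))" for d
    using c(2)[OF that] by (simp only: o_assoc)
  then show "tangent_map M P (H \<circ> F) p v = tangent_map N P H (F p) (tangent_map M N F p v)"
    by (intro ext) (simp add: tangent_map_def)
qed

lemma continuous_map_imp_neighbourhoods:
  assumes "continuous_map X Y F" and "p \<in> topspace X" and "openin Y V" and "F p \<in> V"
  shows "\<exists>U. openin X U \<and> p \<in> U \<and> F ` U \<subseteq> V"
  by (rule exI[of _ "{x \<in> topspace X. F x \<in> V}"])
     (use assms in \<open>auto simp: continuous_map_def\<close>)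

lemma differentiable_mapI:
  assumes M: "differentiable_atlas M" and p: "p \<in> points M"
    and F: "continuous_map (mtop M) (mtop N) F"
    and d: "\<And>d. d \<in> charts_at N (F p) \<Longrightarrow> differentiable_fun M (snd d \<circ> F) p"
  shows "differentiable_map M N F p"
  using p d continuous_map_imp_neighbourhoods[OF F p] continuous_map_image_subset_topspace[OF F]
  unfolding differentiable_map_def by blast

lemma smooth_map_imp_differentiable_map:
  assumes M: "differentiable_atlas M" and F: "smooth_map M N F" and p: "p \<in> points M"
  shows "differentiable_map M N F p"
proof (rule differentiable_mapI[OF M p])
  show "continuous_map (mtop M) (mtop N) F" using F by (simp add: smooth_map_def)
  fix d assume d: "d \<in> charts_at N (F p)"
  have "(snd d \<circ> F \<circ> chart_inv c) differentiable (at (snd c p))" if "c \<in> charts_at M p" for c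
    using F d that by (auto simp: smooth_map_def charts_at_def intro!: smooth_on_imp_differentiable)
  then show "differentiable_fun M (snd d \<circ> F) p" using p by (simp add: differentiable_fun_def)
qed

lemma tangent_map_ident:
  assumes M: "differentiable_atlas M" and p: "p \<in> points M"
  shows "differentiable_map M M (\<lambda>x. x) p"
    and "v \<in> tangent_space M p \<Longrightarrow> tangent_map M M (\<lambda>x. x) p v = v"
proof -
  have c: "differentiable_fun M (snd d \<circ> (\<lambda>x. x)) p" if "d \<in> charts_at M p" for d
    using differentiable_fun_chart[OF M that] by (simp add: comp_def)
  show "differentiable_map M M (\<lambda>x. x) p"
    by (rule differentiable_mapI[OF M p]) (use c in simp_all)
  assume v: "v \<in> tangent_space M p"
  show "tangent_map M M (\<lambda>x. x) p v = v"
  proof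
    fix d
    show "tangent_map M M (\<lambda>x. x) p v d = v d"
    proof (cases "d \<in> charts_at M p")
      case True
      then show ?thesis
        using dfun_in_chart[OF M c[OF True] v True] transition_derivative_self[OF M True]
        by (simp add: tangent_map_def comp_def)
    next
      case False
      then show ?thesis using v by (simp add: tangent_map_def tangent_space_outside)
    qed
  qed
qed

text \<open>
  In a chart the difference has vanishing derivative on a ball, so it is locally constant; hence the
  set where it takes its value at \<open>p\<close> and the complement of that set are both open.
\<close>

lemma equal_dfun_imp_constant_difference:
  fixes F H :: "'a \<Rightarrow> 'f::real_normed_vector"
  assumes S: "smooth_manifold S" and conn: "connected_space (mtop S)"
    and F: "\<And>p. p \<in> points S \<Longrightarrow> differentiable_fun S F p"
    and H: "\<And>p. p \<in> points S \<Longrightarrow> differentiable_fun S H p"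
    and eq: "\<And>p v. p \<in> points S \<Longrightarrow> v \<in> tangent_space S p \<Longrightarrow> dfun S F p v = dfun S H p v"
    and p: "p \<in> points S" and r: "r \<in> points S"
  shows "F p - H p = F r - H r"
proof -
  note at = smooth_manifold_differentiable_atlas[OF S]
  have loc: "\<exists>U. openin (mtop S) U \<and> x \<in> U \<and> (\<forall>y\<in>U. F y - H y = F x - H x)"
    if x: "x \<in> points S" for x
  proof -
    obtain c where c: "c \<in> charts_at S x" using charts_at_nonempty[OF at x] .
    then have ch: "is_chart (mtop S) c" and ca: "c \<in> atlas S" and xc: "x \<in> fst c"
      using S by (auto simp: smooth_manifold_def admissible_chart_def charts_at_def)
    have inj: "inj_on (snd c) (fst c)" and cp: "fst c \<subseteq> points S"
      using at ca by (auto simp: differentiable_atlas_def)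
    have "open (snd c ` fst c)" using ch by (simp add: is_chart_def)
    then obtain e where e: "e > 0" "ball (snd c x) e \<subseteq> snd c ` fst c"
      using xc open_contains_ball by blast
    define U where "U = {y \<in> fst c. snd c y \<in> ball (snd c x) e}"
    let ?D = "\<lambda>y. (F \<circ> chart_inv c) y - (H \<circ> chart_inv c) y"
    have "(?D has_derivative (\<lambda>_. 0)) (at (snd c y))" if y: "y \<in> fst c" for y
    proof -
      have cy: "c \<in> charts_at S y" and yS: "y \<in> points S" using ca y cp by (auto simp: charts_at_def)
      have "(F \<circ> chart_inv c) differentiable (at (snd c y))"
        "(H \<circ> chart_inv c) differentiable (at (snd c y))"
        using F[OF yS] H[OF yS] cy by (auto simp: differentiable_fun_def)
      then have "(?D has_derivative (\<lambda>u. frechet_derivative (F \<circ> chart_inv c) (at (snd c y)) u -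
          frechet_derivative (H \<circ> chart_inv c) (at (snd c y)) u)) (at (snd c y))"
        using frechet_derivative_works by (intro has_derivative_diff) blast+
      moreover have "frechet_derivative (F \<circ> chart_inv c) (at (snd c y)) u =
          frechet_derivative (H \<circ> chart_inv c) (at (snd c y)) u" for u
        using eq[OF yS coord_vec_in_tangent_space(1)[OF at cy]]
          dfun_in_chart[OF at F[OF yS] coord_vec_in_tangent_space(1)[OF at cy] cy, of u]
          dfun_in_chart[OF at H[OF yS] coord_vec_in_tangent_space(1)[OF at cy] cy, of u]
          coord_vec_in_tangent_space(2)[OF at cy, of u] by simp
      ultimately show ?thesis by simp
    qed
    then have "(?D has_derivative (\<lambda>_. 0)) (at z within ball (snd c x) e)"
      if "z \<in> ball (snd c x) e" for z
      using that e(2) has_derivative_at_withinI by blast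
    from has_derivative_zero_unique[OF convex_ball this]
    have const: "?D z = ?D (snd c x)" if "z \<in> ball (snd c x) e" for z
      using that e(1) by (metis centre_in_ball)
    have "F y - H y = F x - H x" if "y \<in> U" for y
      using const[of "snd c y"] that xc chart_inv_inverse[OF inj] by (simp add: U_def)
    moreover have "openin (mtop S) U"
    proof -
      have "continuous_map (subtopology (mtop S) (fst c)) euclidean (snd c)"
        using ch homeomorphic_imp_continuous_map continuous_map_into_fulltopology
        unfolding is_chart_def by blast
      then have "openin (subtopology (mtop S) (fst c))
          {y \<in> topspace (subtopology (mtop S) (fst c)). snd c y \<in> ball (snd c x) e}"
        by (rule openin_continuous_map_preimage) simp
      moreover have "{y \<in> topspace (subtopology (mtop S) (fst c)). snd c y \<in> ball (snd c x) e} = U"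
        using cp by (auto simp: U_def)
      ultimately show ?thesis
        using ch openin_trans_full unfolding is_chart_def by metis
    qed
    moreover have "x \<in> U" using xc e(1) by (simp add: U_def)
    ultimately show ?thesis by blast
  qed
  define A where "A = {x \<in> points S. F x - H x = F p - H p}"
  define B where "B = {x \<in> points S. F x - H x \<noteq> F p - H p}"
  have "openin (mtop S) A"
  proof (subst openin_subopen, intro ballI)
    fix x assume x: "x \<in> A"
    then obtain U where U: "openin (mtop S) U" "x \<in> U" "\<forall>y\<in>U. F y - H y = F x - H x"
      using loc[of x] by (auto simp: A_def)
    have "F y - H y = F p - H p" if "y \<in> U" for y
      using bspec[OF U(3) that] x by (simp add: A_def)
    then have "U \<subseteq> A" using openin_subset[OF U(1)] by (auto simp: A_def)
    then show "\<exists>T. openin (mtop S) T \<and> x \<in> T \<and> T \<subseteq> A" using U by blast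
  qed
  moreover have "openin (mtop S) B"
  proof (subst openin_subopen, intro ballI)
    fix x assume x: "x \<in> B"
    then obtain U where U: "openin (mtop S) U" "x \<in> U" "\<forall>y\<in>U. F y - H y = F x - H x"
      using loc[of x] by (auto simp: B_def)
    have "F y - H y \<noteq> F p - H p" if "y \<in> U" for y
      using bspec[OF U(3) that] x by (simp add: B_def)
    then have "U \<subseteq> B" using openin_subset[OF U(1)] by (auto simp: B_def)
    then show "\<exists>T. openin (mtop S) T \<and> x \<in> T \<and> T \<subseteq> B" using U by blast
  qed
  moreover have "points S \<subseteq> A \<union> B" "A \<inter> B = {}" "p \<in> A" using p by (auto simp: A_def B_def)
  ultimately have "B = {}" using connected_spaceD[OF conn] by blast
  then show ?thesis using r by (auto simp: B_def)
qed

section \<open>Products\<close>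

lemma differentiable_map_const:
  assumes M: "differentiable_atlas M" and p: "p \<in> points M" and b: "b \<in> points N"
  shows "differentiable_map M N (\<lambda>_. b) p" and "tangent_map M N (\<lambda>_. b) p v = (\<lambda>_. 0)"
proof -
  have e: "snd d \<circ> (\<lambda>_. b) \<circ> chart_inv c = (\<lambda>_. snd d b)" for c :: "('a, 'b) chart" and d :: "('c, 'd) chart"
    by auto
  show "differentiable_map M N (\<lambda>_. b) p"
    by (rule differentiable_mapI[OF M p]) (use b p e in \<open>simp_all add: differentiable_fun_def\<close>)
  show "tangent_map M N (\<lambda>_. b) p v = (\<lambda>_. 0)"
    by (auto simp: tangent_map_def dfun_def Let_def e simp del: o_apply comp_apply)
qed

definition prod_chart :: "('a, 'e) chart \<Rightarrow> ('b, 'f) chart \<Rightarrow> ('a \<times> 'b, 'e \<times> 'f) chart" where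
  "prod_chart c d = (fst c \<times> fst d, map_prod (snd c) (snd d))"

lemma charts_at_prod_manifold:
  "charts_at (prod_manifold M N) z =
     {prod_chart c d |c d. c \<in> charts_at M (fst z) \<and> d \<in> charts_at N (snd z)}"
proof
  show "charts_at (prod_manifold M N) z \<subseteq>
      {prod_chart c d |c d. c \<in> charts_at M (fst z) \<and> d \<in> charts_at N (snd z)}"
    unfolding charts_at_def prod_manifold_def prod_chart_def by fastforce
  show "{prod_chart c d |c d. c \<in> charts_at M (fst z) \<and> d \<in> charts_at N (snd z)} \<subseteq>
      charts_at (prod_manifold M N) z"
    unfolding charts_at_def prod_manifold_def prod_chart_def by (cases z) fastforce
qed

lemma points_prod_manifold: "points (prod_manifold M N) = points M \<times> points N"
  by (simp add: prod_manifold_def)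

lemma chart_inv_prod_chart:
  assumes "inj_on (snd c) (fst c)" and "inj_on (snd d) (fst d)"
    and "z \<in> snd c ` fst c \<times> snd d ` fst d"
  shows "chart_inv (prod_chart c d) z = (chart_inv c (fst z), chart_inv d (snd z))"
proof -
  obtain x y where "x \<in> fst c" "y \<in> fst d" "z = (snd c x, snd d y)" using assms(3) by auto
  moreover have "inj_on (snd (prod_chart c d)) (fst (prod_chart c d))"
    using map_prod_inj_on[OF assms(1,2)] by (simp add: prod_chart_def)
  ultimately show ?thesis
    using chart_inv_inverse[of "prod_chart c d" "(x, y)"] chart_inv_inverse[OF assms(1)]
      chart_inv_inverse[OF assms(2)] by (simp add: prod_chart_def)
qed

lemma differentiable_atlas_prod:
  assumes M: "differentiable_atlas M" and N: "differentiable_atlas N"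
  shows "differentiable_atlas (prod_manifold M N)"
proof -
  have Mc: "openin (mtop M) (fst c)" "inj_on (snd c) (fst c)"
      "\<And>U. openin (mtop M) U \<Longrightarrow> U \<subseteq> fst c \<Longrightarrow> open (snd c ` U)" if "c \<in> atlas M" for c
    using M that by (auto simp: differentiable_atlas_def)
  have Nc: "openin (mtop N) (fst c)" "inj_on (snd c) (fst c)"
      "\<And>U. openin (mtop N) U \<Longrightarrow> U \<subseteq> fst c \<Longrightarrow> open (snd c ` U)" if "c \<in> atlas N" for c
    using N that by (auto simp: differentiable_atlas_def)
  have at: "e \<in> atlas (prod_manifold M N) \<longleftrightarrow>
      (\<exists>c d. c \<in> atlas M \<and> d \<in> atlas N \<and> e = prod_chart c d)" for e
    by (auto simp: prod_manifold_def prod_chart_def)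
  have "(\<Union>e\<in>atlas (prod_manifold M N). fst e) = (\<Union>c\<in>atlas M. fst c) \<times> (\<Union>d\<in>atlas N. fst d)"
    by (auto simp: prod_manifold_def) blast
  then have cover: "(\<Union>e\<in>atlas (prod_manifold M N). fst e) = points (prod_manifold M N)"
    using M N by (simp add: points_prod_manifold differentiable_atlas_def)
  have im: "open (snd (prod_chart c d) ` U)"
    if c: "c \<in> atlas M" and d: "d \<in> atlas N" and U: "openin (mtop (prod_manifold M N)) U"
      "U \<subseteq> fst (prod_chart c d)" for c d U
  proof (rule Topological_Spaces.openI)
    fix z assume "z \<in> snd (prod_chart c d) ` U"
    then obtain x y where xy: "(x, y) \<in> U" "z = (snd c x, snd d y)"
      by (auto simp: prod_chart_def)
    obtain A B where AB: "openin (mtop M) A" "openin (mtop N) B" "x \<in> A" "y \<in> B" "A \<times> B \<subseteq> U"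
      using U(1) xy(1) unfolding prod_manifold_def manifold.simps openin_prod_topology_alt by metis
    have "A \<times> B \<subseteq> fst c \<times> fst d" using AB(5) U(2) by (simp add: prod_chart_def)
    then have "A \<subseteq> fst c" "B \<subseteq> fst d" using AB(3,4) by auto
    then have "open (snd c ` A \<times> snd d ` B)"
      using Mc(3)[OF c AB(1)] Nc(3)[OF d AB(2)] by (simp add: open_Times)
    moreover have "snd c ` A \<times> snd d ` B \<subseteq> snd (prod_chart c d) ` U"
    proof
      fix w assume "w \<in> snd c ` A \<times> snd d ` B"
      then obtain a b where "a \<in> A" "b \<in> B" "w = snd (prod_chart c d) (a, b)"
        by (auto simp: prod_chart_def)
      then show "w \<in> snd (prod_chart c d) ` U" using AB(5) by blast
    qed
    moreover have "z \<in> snd c ` A \<times> snd d ` B" using xy(2) AB(3,4) by simp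
    ultimately show "\<exists>T. open T \<and> z \<in> T \<and> T \<subseteq> snd (prod_chart c d) ` U" by blast
  qed
  have trans: "(snd (prod_chart c' d') \<circ> chart_inv (prod_chart c d)) differentiable
      (at (snd (prod_chart c d) z))"
    if c: "c \<in> atlas M" "c' \<in> atlas M" and d: "d \<in> atlas N" "d' \<in> atlas N"
      and z: "z \<in> fst (prod_chart c d) \<inter> fst (prod_chart c' d')" for c c' d d' z
  proof -
    obtain x y where xy: "z = (x, y)" by (cases z)
    let ?A = "snd c ` fst c" and ?B = "snd d ` fst d"
    let ?F = "\<lambda>w. ((snd c' \<circ> chart_inv c) (fst w), (snd d' \<circ> chart_inv d) (snd w))"
    have "open (?A \<times> ?B)"
      using Mc(3)[OF c(1) Mc(1)[OF c(1)]] Nc(3)[OF d(1) Nc(1)[OF d(1)]] by (simp add: open_Times)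
    moreover have "snd (prod_chart c d) z \<in> ?A \<times> ?B"
      using z by (auto simp: prod_chart_def)
    moreover have "?F w = (snd (prod_chart c' d') \<circ> chart_inv (prod_chart c d)) w"
      if "w \<in> ?A \<times> ?B" for w
      using chart_inv_prod_chart[OF Mc(2)[OF c(1)] Nc(2)[OF d(1)] that] by (simp add: prod_chart_def)
    ultimately have ev: "\<forall>\<^sub>F w in nhds (snd (prod_chart c d) z).
        ?F w = (snd (prod_chart c' d') \<circ> chart_inv (prod_chart c d)) w"
      unfolding eventually_nhds by (intro exI[of _ "?A \<times> ?B"] conjI ballI)
    have "(snd c' \<circ> chart_inv c) differentiable (at (fst (snd (prod_chart c d) z)))"
      using M c z by (auto simp: prod_chart_def differentiable_atlas_def)
    moreover have "(snd d' \<circ> chart_inv d) differentiable (at (snd (snd (prod_chart c d) z)))"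
      using N d z by (auto simp: prod_chart_def differentiable_atlas_def)
    ultimately have "?F differentiable (at (snd (prod_chart c d) z))"
      using differentiable_compose[OF _ differentiable_fst_at] differentiable_compose[OF _ differentiable_snd_at]
      by (intro differentiable_Pair) blast+
    then show ?thesis by (rule differentiable_cong_nhds(1)[OF ev])
  qed
  show ?thesis
    unfolding differentiable_atlas_def
  proof (intro conjI ballI allI impI)
    show "(\<Union>e\<in>atlas (prod_manifold M N). fst e) = points (prod_manifold M N)" by (rule cover)
  next
    fix e assume "e \<in> atlas (prod_manifold M N)"
    then obtain c d where e: "c \<in> atlas M" "d \<in> atlas N" "e = prod_chart c d" using at by blast
    show "openin (mtop (prod_manifold M N)) (fst e)"
      using Mc(1)[OF e(1)] Nc(1)[OF e(2)] by (simp add: e(3) prod_chart_def prod_manifold_def openin_prod_Times_iff)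
    show "inj_on (snd e) (fst e)"
      using map_prod_inj_on[OF Mc(2)[OF e(1)] Nc(2)[OF e(2)]] by (simp add: e(3) prod_chart_def)
    fix U assume "openin (mtop (prod_manifold M N)) U" "U \<subseteq> fst e"
    then show "open (snd e ` U)" using im[OF e(1,2)] e(3) by blast
  next
    fix e e' z
    assume "e \<in> atlas (prod_manifold M N)" "e' \<in> atlas (prod_manifold M N)"
      and z: "z \<in> fst e \<inter> fst e'"
    then obtain c d c' d' where e: "c \<in> atlas M" "d \<in> atlas N" "e = prod_chart c d"
      and e': "c' \<in> atlas M" "d' \<in> atlas N" "e' = prod_chart c' d'" using at by meson
    show "(snd e' \<circ> chart_inv e) differentiable (at (snd e z))"
      using trans[OF e(1) e'(1) e(2) e'(2)] z e(3) e'(3) by blast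
  qed
qed

text \<open>In the chart \<open>prod_chart c d\<close> the projections are the linear maps \<open>fst\<close> and \<open>snd\<close>.\<close>

lemma differentiable_map_fst:
  assumes M: "differentiable_atlas M" and N: "differentiable_atlas N"
    and z: "z \<in> points (prod_manifold M N)"
  shows "differentiable_map (prod_manifold M N) M fst z"
    and "w \<in> tangent_space (prod_manifold M N) z \<Longrightarrow> c \<in> charts_at M (fst z) \<Longrightarrow>
      d \<in> charts_at N (snd z) \<Longrightarrow>
      tangent_map (prod_manifold M N) M fst z w c = fst (w (prod_chart c d))"
proof -
  let ?P = "prod_manifold M N"
  note P = differentiable_atlas_prod[OF M N]
  have ch: "prod_chart c d \<in> charts_at ?P z"
    and ev: "\<forall>\<^sub>F y in nhds (snd (prod_chart c d) z). fst y = (snd c \<circ> fst \<circ> chart_inv (prod_chart c d)) y"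
    if "c \<in> charts_at M (fst z)" "d \<in> charts_at N (snd z)" for c d
  proof -
    show ch: "prod_chart c d \<in> charts_at ?P z" using that unfolding charts_at_prod_manifold by blast
    show "\<forall>\<^sub>F y in nhds (snd (prod_chart c d) z). fst y = (snd c \<circ> fst \<circ> chart_inv (prod_chart c d)) y"
      using eventually_chart_inv[OF P ch openin_topspace z]
      by eventually_elim (simp add: prod_chart_def prod_eq_iff)
  qed
  obtain d0 where d0: "d0 \<in> charts_at N (snd z)"
    using charts_at_nonempty[OF N, of "snd z"] z unfolding points_prod_manifold by (metis mem_Times_iff)
  have f: "differentiable_fun ?P (snd c \<circ> fst) z" if "c \<in> charts_at M (fst z)" for c
    by (rule differentiable_funI[OF P ch[OF that d0]])
       (rule differentiable_cong_nhds(1)[OF ev[OF that d0] differentiable_fst_at])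
  show "differentiable_map ?P M fst z"
    by (rule differentiable_mapI[OF P z]) (use f in \<open>simp_all add: prod_manifold_def continuous_map_fst\<close>)
  assume w: "w \<in> tangent_space ?P z" and c: "c \<in> charts_at M (fst z)" and d: "d \<in> charts_at N (snd z)"
  have "frechet_derivative (snd c \<circ> fst \<circ> chart_inv (prod_chart c d)) (at (snd (prod_chart c d) z)) =
      frechet_derivative fst (at (snd (prod_chart c d) z))"
    by (rule differentiable_cong_nhds(2)[OF ev[OF c d] differentiable_fst_at])
  then show "tangent_map ?P M fst z w c = fst (w (prod_chart c d))"
    using dfun_in_chart[OF P f[OF c] w ch[OF c d]] c by (simp add: tangent_map_def frechet_derivative_fst)
qed

lemma differentiable_map_snd:
  assumes M: "differentiable_atlas M" and N: "differentiable_atlas N"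
    and z: "z \<in> points (prod_manifold M N)"
  shows "differentiable_map (prod_manifold M N) N snd z"
    and "w \<in> tangent_space (prod_manifold M N) z \<Longrightarrow> c \<in> charts_at M (fst z) \<Longrightarrow>
      d \<in> charts_at N (snd z) \<Longrightarrow>
      tangent_map (prod_manifold M N) N snd z w d = snd (w (prod_chart c d))"
proof -
  let ?P = "prod_manifold M N"
  note P = differentiable_atlas_prod[OF M N]
  have ch: "prod_chart c d \<in> charts_at ?P z"
    and ev: "\<forall>\<^sub>F y in nhds (snd (prod_chart c d) z). snd y = (snd d \<circ> snd \<circ> chart_inv (prod_chart c d)) y"
    if "c \<in> charts_at M (fst z)" "d \<in> charts_at N (snd z)" for c d
  proof -
    show ch: "prod_chart c d \<in> charts_at ?P z" using that unfolding charts_at_prod_manifold by blast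
    show "\<forall>\<^sub>F y in nhds (snd (prod_chart c d) z). snd y = (snd d \<circ> snd \<circ> chart_inv (prod_chart c d)) y"
      using eventually_chart_inv[OF P ch openin_topspace z]
      by eventually_elim (simp add: prod_chart_def prod_eq_iff)
  qed
  obtain c0 where c0: "c0 \<in> charts_at M (fst z)"
    using charts_at_nonempty[OF M, of "fst z"] z unfolding points_prod_manifold by (metis mem_Times_iff)
  have f: "differentiable_fun ?P (snd d \<circ> snd) z" if "d \<in> charts_at N (snd z)" for d
    by (rule differentiable_funI[OF P ch[OF c0 that]])
       (rule differentiable_cong_nhds(1)[OF ev[OF c0 that] differentiable_snd_at])
  show "differentiable_map ?P N snd z"
    by (rule differentiable_mapI[OF P z]) (use f in \<open>simp_all add: prod_manifold_def continuous_map_snd\<close>)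
  assume w: "w \<in> tangent_space ?P z" and c: "c \<in> charts_at M (fst z)" and d: "d \<in> charts_at N (snd z)"
  have "frechet_derivative (snd d \<circ> snd \<circ> chart_inv (prod_chart c d)) (at (snd (prod_chart c d) z)) =
      frechet_derivative snd (at (snd (prod_chart c d) z))"
    by (rule differentiable_cong_nhds(2)[OF ev[OF c d] differentiable_snd_at])
  then show "tangent_map ?P N snd z w d = snd (w (prod_chart c d))"
    using dfun_in_chart[OF P f[OF d] w ch[OF c d]] d by (simp add: tangent_map_def frechet_derivative_snd)
qed

text \<open>In the chart \<open>prod_chart c d\<close> the two components of a tangent vector are its projections.\<close>

lemma prod_tangent_eqI:
  assumes M: "differentiable_atlas M" and N: "differentiable_atlas N"
    and z: "z \<in> points (prod_manifold M N)"
    and w: "w \<in> tangent_space (prod_manifold M N) z" "w' \<in> tangent_space (prod_manifold M N) z"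
    and fst: "tangent_map (prod_manifold M N) M fst z w = tangent_map (prod_manifold M N) M fst z w'"
    and snd: "tangent_map (prod_manifold M N) N snd z w = tangent_map (prod_manifold M N) N snd z w'"
  shows "w = w'"
proof -
  obtain c where c: "c \<in> charts_at M (fst z)"
    using charts_at_nonempty[OF M, of "fst z"] z unfolding points_prod_manifold by (metis mem_Times_iff)
  obtain d where d: "d \<in> charts_at N (snd z)"
    using charts_at_nonempty[OF N, of "snd z"] z unfolding points_prod_manifold by (metis mem_Times_iff)
  have "prod_chart c d \<in> charts_at (prod_manifold M N) z"
    using c d unfolding charts_at_prod_manifold by blast
  moreover have "w (prod_chart c d) = w' (prod_chart c d)"
    using differentiable_map_fst(2)[OF M N z w(1) c d] differentiable_map_fst(2)[OF M N z w(2) c d]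
      differentiable_map_snd(2)[OF M N z w(1) c d] differentiable_map_snd(2)[OF M N z w(2) c d] fst snd
    by (simp add: prod_eq_iff)
  ultimately show ?thesis by (rule tangent_vec_eqI[OF w])
qed

lemma differentiable_map_Pair:
  assumes L: "differentiable_atlas L"
    and F: "differentiable_map L M F p" and H: "differentiable_map L N H p"
  shows "differentiable_map L (prod_manifold M N) (\<lambda>x. (F x, H x)) p"
  unfolding differentiable_map_def
proof (intro conjI ballI allI impI)
  show "p \<in> points L" using F by (simp add: differentiable_map_def)
  show "(F p, H p) \<in> points (prod_manifold M N)"
    using F H by (simp add: differentiable_map_def points_prod_manifold)
next
  fix V assume "openin (mtop (prod_manifold M N)) V" "(F p, H p) \<in> V"
  then obtain A B where AB: "openin (mtop M) A" "openin (mtop N) B" "F p \<in> A" "H p \<in> B" "A \<times> B \<subseteq> V"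
    unfolding prod_manifold_def manifold.simps openin_prod_topology_alt by metis
  obtain U where U: "openin (mtop L) U" "p \<in> U" "F ` U \<subseteq> A"
    using F AB(1,3) unfolding differentiable_map_def by metis
  obtain U' where U': "openin (mtop L) U'" "p \<in> U'" "H ` U' \<subseteq> B"
    using H AB(2,4) unfolding differentiable_map_def by metis
  have "openin (mtop L) (U \<inter> U')" "p \<in> U \<inter> U'" "(\<lambda>x. (F x, H x)) ` (U \<inter> U') \<subseteq> V"
    using U U' AB(5) by auto
  then show "\<exists>U. openin (mtop L) U \<and> p \<in> U \<and> (\<lambda>x. (F x, H x)) ` U \<subseteq> V" by blast
next
  fix e assume "e \<in> charts_at (prod_manifold M N) (F p, H p)"
  then obtain c d where cd: "c \<in> charts_at M (F p)" "d \<in> charts_at N (H p)" "e = prod_chart c d"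
    by (auto simp: charts_at_prod_manifold)
  have f: "differentiable_fun L (snd c \<circ> F) p" "differentiable_fun L (snd d \<circ> H) p"
    using F H cd by (auto simp: differentiable_map_def)
  have e: "snd e \<circ> (\<lambda>x. (F x, H x)) \<circ> chart_inv b =
      (\<lambda>y. ((snd c \<circ> F \<circ> chart_inv b) y, (snd d \<circ> H \<circ> chart_inv b) y))" for b
    by (auto simp: cd(3) prod_chart_def)
  then show "differentiable_fun L (snd e \<circ> (\<lambda>x. (F x, H x))) p"
    using f unfolding differentiable_fun_def e by (auto simp del: o_apply comp_apply)
qed

lemma tangent_map_prod_slice:
  assumes M: "differentiable_atlas M" and N: "differentiable_atlas N"
    and p: "p \<in> points M" and b: "b \<in> points N"
  shows "differentiable_map M (prod_manifold M N) (\<lambda>x. (x, b)) p"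
    and "v \<in> tangent_space M p \<Longrightarrow> tangent_map (prod_manifold M N) M fst (p, b)
      (tangent_map M (prod_manifold M N) (\<lambda>x. (x, b)) p v) = v"
    and "tangent_map (prod_manifold M N) N snd (p, b)
      (tangent_map M (prod_manifold M N) (\<lambda>x. (x, b)) p v) = (\<lambda>_. 0)"
proof -
  note P = differentiable_atlas_prod[OF M N]
  have z: "(p, b) \<in> points (prod_manifold M N)" using p b by (simp add: points_prod_manifold)
  show s: "differentiable_map M (prod_manifold M N) (\<lambda>x. (x, b)) p"
    by (rule differentiable_map_Pair[OF M tangent_map_ident(1)[OF M p] differentiable_map_const(1)[OF M p b]])
  show "tangent_map (prod_manifold M N) M fst (p, b)
      (tangent_map M (prod_manifold M N) (\<lambda>x. (x, b)) p v) = v" if "v \<in> tangent_space M p"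
    using tangent_map_comp(2)[OF M P s differentiable_map_fst(1)[OF M N z]] tangent_map_ident(2)[OF M p that]
    by (simp add: comp_def)
  show "tangent_map (prod_manifold M N) N snd (p, b)
      (tangent_map M (prod_manifold M N) (\<lambda>x. (x, b)) p v) = (\<lambda>_. 0)"
    using tangent_map_comp(2)[OF M P s differentiable_map_snd(1)[OF M N z]]
      differentiable_map_const(2)[OF M p b]
    by (simp add: comp_def)
qed

section \<open>The model space as a manifold\<close>

lemma chart_inv_id: "chart_inv (UNIV, id) = id"
  by (simp add: chart_inv_def fun_eq_iff inv_id[unfolded id_def] id_def)

lemma charts_at_model_manifold: "charts_at model_manifold p = {(UNIV, id)}"
  by (auto simp: charts_at_def model_manifold_def)

lemma points_model_manifold: "points model_manifold = UNIV"
  by (simp add: model_manifold_def)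

lemma differentiable_atlas_model_manifold: "differentiable_atlas model_manifold"
  by (simp add: differentiable_atlas_def model_manifold_def chart_inv_id) (simp add: id_def)

lemma differentiable_fun_model_manifold:
  "differentiable_fun model_manifold F t \<longleftrightarrow> F differentiable (at t)"
  by (simp add: differentiable_fun_def charts_at_model_manifold points_model_manifold chart_inv_id)

lemma dfun_model_manifold:
  "dfun model_manifold F t v = frechet_derivative F (at t) (v (UNIV, id))"
  by (simp add: dfun_def some_chart_def charts_at_model_manifold chart_inv_id Let_def)

lemma tangent_map_model_manifold:
  "tangent_map M model_manifold F p v = (\<lambda>c. if c = (UNIV, id) then dfun M F p v else 0)"
  by (auto simp: tangent_map_def charts_at_model_manifold)

lemma differentiable_map_model_manifold:
  assumes "differentiable_map M model_manifold F p"
  shows "differentiable_fun M F p"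
  using assms by (simp add: differentiable_map_def charts_at_model_manifold)

section \<open>Quotients by deck transformations\<close>

lemma topspace_quotient_topology: "topspace (quotient_topology X q) = q ` topspace X"
proof
  have "openin (quotient_topology X q) (topspace (quotient_topology X q))" by (rule openin_topspace)
  then show "topspace (quotient_topology X q) \<subseteq> q ` topspace X"
    unfolding openin_quotient_topology by (rule conjunct1)
  have "{x \<in> topspace X. q x \<in> q ` topspace X} = topspace X" by blast
  then have "openin (quotient_topology X q) (q ` topspace X)"
    by (simp add: openin_quotient_topology)
  then show "q ` topspace X \<subseteq> topspace (quotient_topology X q)" by (rule openin_subset)
qed

text \<open>The elements of \<open>\<Gamma>\<close> are the deck transformations of \<open>q\<close>: its fibres are their orbits. Both the circle
  and the mapping torus are quotients of this kind.\<close>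

locale deck_quotient =
  fixes M :: "('a, 'e::real_normed_vector) manifold" and q :: "'a \<Rightarrow> 'b" and \<Gamma> :: "('a \<Rightarrow> 'a) set"
  assumes M: "differentiable_atlas M"
    and deck_continuous: "\<gamma> \<in> \<Gamma> \<Longrightarrow> continuous_map (mtop M) (mtop M) \<gamma>"
    and deck_differentiable: "\<gamma> \<in> \<Gamma> \<Longrightarrow> p \<in> points M \<Longrightarrow> differentiable_map M M \<gamma> p"
    and fibre: "x \<in> points M \<Longrightarrow> y \<in> points M \<Longrightarrow> q x = q y \<longleftrightarrow> (\<exists>\<gamma>\<in>\<Gamma>. y = \<gamma> x)"
    and locally_injective: "x \<in> points M \<Longrightarrow> \<exists>W. openin (mtop M) W \<and> x \<in> W \<and> inj_on q W"
begin

abbreviation N where "N \<equiv> quotient_manifold M q"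

lemma points_quotient: "points N = q ` points M"
  by (simp add: quotient_manifold_def topspace_quotient_topology)

lemma deck_in_points: "\<gamma> \<in> \<Gamma> \<Longrightarrow> x \<in> points M \<Longrightarrow> \<gamma> x \<in> points M"
  using deck_continuous continuous_map_image_subset_topspace by fastforce

lemma q_deck: "\<gamma> \<in> \<Gamma> \<Longrightarrow> x \<in> points M \<Longrightarrow> q (\<gamma> x) = q x"
  using fibre deck_in_points by metis

lemma openin_quotient:
  "openin (mtop N) V \<longleftrightarrow> V \<subseteq> q ` points M \<and> openin (mtop M) {x \<in> points M. q x \<in> V}"
  by (simp add: quotient_manifold_def openin_quotient_topology)

lemma continuous_map_q: "continuous_map (mtop M) (mtop N) q"
  unfolding continuous_map_def by (auto simp: points_quotient openin_quotient)

text \<open>The saturation of \<open>W\<close> is the union of the preimages of \<open>W\<close> under the deck transformations.\<close>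

lemma q_open_image:
  assumes W: "openin (mtop M) W"
  shows "openin (mtop N) (q ` W)"
proof -
  have WM: "W \<subseteq> points M" using W by (rule openin_subset)
  have "{x \<in> points M. q x \<in> q ` W} = (\<Union>\<gamma>\<in>\<Gamma>. {x \<in> points M. \<gamma> x \<in> W})"
  proof
    show "{x \<in> points M. q x \<in> q ` W} \<subseteq> (\<Union>\<gamma>\<in>\<Gamma>. {x \<in> points M. \<gamma> x \<in> W})"
    proof
      fix x assume "x \<in> {x \<in> points M. q x \<in> q ` W}"
      then obtain w where w: "x \<in> points M" "w \<in> W" "q x = q w" by auto
      then obtain \<gamma> where "\<gamma> \<in> \<Gamma>" "w = \<gamma> x" using fibre[of x w] WM by blast
      then show "x \<in> (\<Union>\<gamma>\<in>\<Gamma>. {x \<in> points M. \<gamma> x \<in> W})" using w by blast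
    qed
    show "(\<Union>\<gamma>\<in>\<Gamma>. {x \<in> points M. \<gamma> x \<in> W}) \<subseteq> {x \<in> points M. q x \<in> q ` W}"
    proof
      fix x assume "x \<in> (\<Union>\<gamma>\<in>\<Gamma>. {x \<in> points M. \<gamma> x \<in> W})"
      then obtain \<gamma> where "\<gamma> \<in> \<Gamma>" "x \<in> points M" "\<gamma> x \<in> W" by blast
      then show "x \<in> {x \<in> points M. q x \<in> q ` W}" using q_deck[of \<gamma> x] imageI[of "\<gamma> x" W q] by simp
    qed
  qed
  moreover have "openin (mtop M) {x \<in> points M. \<gamma> x \<in> W}" if "\<gamma> \<in> \<Gamma>" for \<gamma>
    using deck_continuous[OF that] W by (rule openin_continuous_map_preimage)
  ultimately show ?thesis using WM by (auto simp: openin_quotient)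
qed

text \<open>The chart of the quotient that \<open>c\<close> induces on a sheet \<open>W\<close>, a set that \<open>q\<close> maps bijectively onto its
  image; \<open>quotient_manifold M q\<close> has exactly these charts.\<close>

definition sheet_chart :: "('a, 'e) chart \<Rightarrow> 'a set \<Rightarrow> ('b, 'e) chart" where
  "sheet_chart c W = (q ` W, snd c \<circ> inv_into W q)"

lemma charts_at_quotientE:
  assumes "x \<in> points M" and "d \<in> charts_at N (q x)"
  obtains c W \<gamma> where "c \<in> atlas M" and "openin (mtop M) W" and "W \<subseteq> fst c" and "inj_on q W"
    and "d = sheet_chart c W" and "\<gamma> \<in> \<Gamma>" and "\<gamma> x \<in> W"
proof -
  obtain c W where cW: "c \<in> atlas M" "openin (mtop M) W" "W \<subseteq> fst c" "inj_on q W"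
    "d = sheet_chart c W" and "q x \<in> fst d"
    using assms(2) by (auto simp: charts_at_def quotient_manifold_def sheet_chart_def)
  then obtain w where w: "w \<in> W" "q x = q w" by (auto simp: sheet_chart_def)
  then obtain \<gamma> where "\<gamma> \<in> \<Gamma>" "w = \<gamma> x"
    using fibre[OF assms(1), of w] openin_subset[OF cW(2)] by blast
  then show thesis using that cW w(1) by blast
qed

lemma sheet_chart_at:
  assumes "c \<in> charts_at M x"
  obtains W where "openin (mtop M) W" and "x \<in> W" and "W \<subseteq> fst c" and "inj_on q W"
    and "sheet_chart c W \<in> charts_at N (q x)"
proof -
  have c: "openin (mtop M) (fst c)" "x \<in> fst c" "c \<in> atlas M"
    using assms M by (auto simp: charts_at_def differentiable_atlas_def)
  obtain W where W: "openin (mtop M) W" "x \<in> W" "inj_on q W"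
    using locally_injective[OF charts_at_in_points[OF M assms]] by blast
  have W': "openin (mtop M) (W \<inter> fst c)" "x \<in> W \<inter> fst c" "W \<inter> fst c \<subseteq> fst c" "inj_on q (W \<inter> fst c)"
    using W c by (auto intro: inj_on_subset)
  have "(q ` (W \<inter> fst c), snd c \<circ> inv_into (W \<inter> fst c) q) \<in> atlas N"
    using W' c(3) unfolding quotient_manifold_def manifold.simps mem_Collect_eq by blast
  then have "sheet_chart c (W \<inter> fst c) \<in> charts_at N (q x)"
    using W'(2) by (auto simp: charts_at_def sheet_chart_def)
  then show thesis using that W' by blast
qed

lemma sheet_chart_value:
  "inj_on q W \<Longrightarrow> x \<in> W \<Longrightarrow> snd (sheet_chart c W) (q x) = snd c x"
  by (simp add: sheet_chart_def)

lemma inj_on_sheet_chart: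
  assumes "inj_on (snd c) (fst c)" and "W \<subseteq> fst c" and "inj_on q W"
  shows "inj_on (snd (sheet_chart c W)) (fst (sheet_chart c W))"
proof (rule inj_onI)
  fix y y' assume "y \<in> fst (sheet_chart c W)" "y' \<in> fst (sheet_chart c W)"
    and eq: "snd (sheet_chart c W) y = snd (sheet_chart c W) y'"
  then obtain x x' where x: "x \<in> W" "y = q x" "x' \<in> W" "y' = q x'" by (auto simp: sheet_chart_def)
  then have "snd c x = snd c x'" using eq sheet_chart_value[OF assms(3)] by metis
  then show "y = y'" using x assms(1,2) by (auto dest: inj_onD)
qed

lemma chart_inv_sheet_chart:
  assumes "inj_on (snd c) (fst c)" and "W \<subseteq> fst c" and "inj_on q W" and "y \<in> W"
  shows "chart_inv (sheet_chart c W) (snd c y) = q y"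
  using chart_inv_inverse[OF inj_on_sheet_chart[OF assms(1-3)], of "q y"] assms(4)
  by (simp add: sheet_chart_value[OF assms(3)]) (simp add: sheet_chart_def)

text \<open>Near \<open>x\<close>, a chart of the quotient at \<open>q x\<close>, read through \<open>q\<close>, is a chart of \<open>M\<close> after a deck
  transformation.\<close>

lemma quotient_chart_comp_q:
  assumes x: "x \<in> points M" and d: "d \<in> charts_at N (q x)"
  shows "differentiable_fun M (snd d \<circ> q) x"
proof -
  obtain c W \<gamma> where c: "c \<in> atlas M" and W: "openin (mtop M) W" "W \<subseteq> fst c" "inj_on q W"
    and d: "d = sheet_chart c W" and g: "\<gamma> \<in> \<Gamma>" "\<gamma> x \<in> W"
    using charts_at_quotientE[OF x d] .
  let ?U = "{z \<in> points M. \<gamma> z \<in> W}"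
  have U: "openin (mtop M) ?U" "x \<in> ?U"
    using openin_continuous_map_preimage[OF deck_continuous[OF g(1)] W(1)] x g(2) by auto
  have "c \<in> charts_at M (\<gamma> x)" using c W(2) g(2) by (auto simp: charts_at_def)
  then have "differentiable_fun M (snd c \<circ> \<gamma>) x"
    using deck_differentiable[OF g(1) x] by (simp add: differentiable_map_def)
  moreover have "(snd c \<circ> \<gamma>) z = (snd d \<circ> q) z" if "z \<in> ?U" for z
    using sheet_chart_value[OF W(3), of "\<gamma> z" c] that q_deck[OF g(1), of z] d by simp
  ultimately show ?thesis using differentiable_fun_cong(1)[OF M _ U] by blast
qed

lemma eventually_chart_inv_sheet_chart:
  assumes c: "c \<in> charts_at M x" and W: "openin (mtop M) W" "x \<in> W" "W \<subseteq> fst c" "inj_on q W"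
  shows "\<forall>\<^sub>F a in nhds (snd c x). (F \<circ> q \<circ> chart_inv c) a = (F \<circ> chart_inv (sheet_chart c W)) a"
proof -
  have "inj_on (snd c) (fst c)" using c M by (auto simp: charts_at_def differentiable_atlas_def)
  note i = chart_inv_sheet_chart[OF this W(3,4)]
  show ?thesis
    using eventually_chart_inv[OF M c W(1,2)]
  proof eventually_elim
    case (elim a)
    then show ?case using i[of "chart_inv c a"] by simp
  qed
qed

text \<open>A transition map of the quotient is \<open>snd e \<circ> q\<close> read in a chart \<open>c\<close> of \<open>M\<close>, which is differentiable by
  the preceding description of \<open>snd e \<circ> q\<close>.\<close>

lemma differentiable_atlas_quotient: "differentiable_atlas N"
  unfolding differentiable_atlas_def
proof (intro conjI ballI allI impI)
  have "y \<in> (\<Union>d\<in>atlas N. fst d)" if "y \<in> points N" for y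
  proof -
    obtain x where x: "x \<in> points M" "y = q x" using \<open>y \<in> points N\<close> unfolding points_quotient by blast
    obtain c where "c \<in> charts_at M x" using charts_at_nonempty[OF M x(1)] .
    from sheet_chart_at[OF this] show ?thesis using x(2) by (auto simp: charts_at_def)
  qed
  moreover have "fst d \<subseteq> points N" if "d \<in> atlas N" for d
    using that points_quotient openin_subset by (fastforce simp: quotient_manifold_def)
  ultimately show "(\<Union>d\<in>atlas N. fst d) = points N" by blast
next
  fix d assume "d \<in> atlas N"
  then obtain c W where c: "c \<in> atlas M" and W: "openin (mtop M) W" "W \<subseteq> fst c" "inj_on q W"
    and d: "d = sheet_chart c W" by (auto simp: quotient_manifold_def sheet_chart_def)
  have cc: "inj_on (snd c) (fst c)"
    "\<And>U. openin (mtop M) U \<Longrightarrow> U \<subseteq> fst c \<Longrightarrow> open (snd c ` U)"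
    using c M by (auto simp: differentiable_atlas_def)
  show "openin (mtop N) (fst d)" using q_open_image[OF W(1)] d by (simp add: sheet_chart_def)
  show "inj_on (snd d) (fst d)" using inj_on_sheet_chart[OF cc(1) W(2,3)] d by simp
  fix V assume V: "openin (mtop N) V" "V \<subseteq> fst d"
  have WM: "W \<subseteq> points M" using W(1) by (rule openin_subset)
  let ?U = "W \<inter> {x \<in> points M. q x \<in> V}"
  have "V = q ` ?U" using V(2) WM by (auto simp: d sheet_chart_def)
  moreover have "snd d ` (q ` ?U) = snd c ` ?U"
    unfolding image_image d by (rule image_cong) (use sheet_chart_value[OF W(3)] in auto)
  moreover have "open (snd c ` ?U)" using cc(2) V(1) W by (auto simp: openin_quotient)
  ultimately show "open (snd d ` V)" by metis
next
  fix d e y assume "d \<in> atlas N" and e: "e \<in> atlas N" and y: "y \<in> fst d \<inter> fst e"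
  then obtain c W where c: "c \<in> atlas M" and W: "openin (mtop M) W" "W \<subseteq> fst c" "inj_on q W"
    and d: "d = sheet_chart c W" by (auto simp: quotient_manifold_def sheet_chart_def)
  obtain x where x: "x \<in> W" "y = q x" using y d by (auto simp: sheet_chart_def)
  have xM: "x \<in> points M" using x(1) openin_subset[OF W(1)] by blast
  have cx: "c \<in> charts_at M x" using c W(2) x(1) by (auto simp: charts_at_def)
  have "e \<in> charts_at N (q x)" using e y x(2) by (simp add: charts_at_def)
  then have "(snd e \<circ> q \<circ> chart_inv c) differentiable (at (snd c x))"
    using quotient_chart_comp_q[OF xM] cx by (simp add: differentiable_fun_def)
  then have "(snd e \<circ> chart_inv d) differentiable (at (snd c x))"
    unfolding d by (rule differentiable_cong_nhds(1)[OF eventually_chart_inv_sheet_chart[OF cx W(1) x(1) W(2,3)]])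
  then show "(snd e \<circ> chart_inv d) differentiable (at (snd d y))"
    by (simp add: d x(2) sheet_chart_value[OF W(3) x(1)])
qed

lemma differentiable_map_q:
  assumes "x \<in> points M"
  shows "differentiable_map M N q x"
  by (rule differentiable_mapI[OF M assms continuous_map_q quotient_chart_comp_q[OF assms]])

lemma continuous_map_quotientI:
  assumes "continuous_map (mtop M) Y (F \<circ> q)"
  shows "continuous_map (mtop N) Y F"
proof -
  have "{x \<in> points M. q x \<in> {y \<in> q ` points M. F y \<in> V}} = {x \<in> points M. (F \<circ> q) x \<in> V}" for V
    by auto
  moreover have "openin (mtop M) {x \<in> points M. (F \<circ> q) x \<in> V}" if "openin Y V" for V
    using openin_continuous_map_preimage[OF assms that] .
  ultimately show ?thesis
    using continuous_map_image_subset_topspace[OF assms]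
    unfolding continuous_map_def openin_quotient points_quotient by (auto simp: image_subset_iff)
qed

lemma differentiable_fun_quotientI:
  assumes F: "differentiable_fun M (F \<circ> q) x"
  shows "differentiable_fun N F (q x)"
proof -
  have "x \<in> points M" using F by (simp add: differentiable_fun_def)
  then obtain c where c: "c \<in> charts_at M x" using charts_at_nonempty[OF M] by blast
  obtain W where W: "openin (mtop M) W" "x \<in> W" "W \<subseteq> fst c" "inj_on q W"
    "sheet_chart c W \<in> charts_at N (q x)" using sheet_chart_at[OF c] .
  have "(F \<circ> q \<circ> chart_inv c) differentiable (at (snd c x))"
    using F c by (simp add: differentiable_fun_def)
  then have "(F \<circ> chart_inv (sheet_chart c W)) differentiable (at (snd c x))"
    by (rule differentiable_cong_nhds(1)[OF eventually_chart_inv_sheet_chart[OF c W(1-4)]])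
  then have "(F \<circ> chart_inv (sheet_chart c W)) differentiable (at (snd (sheet_chart c W) (q x)))"
    by (simp add: sheet_chart_value[OF W(4,2)])
  then show ?thesis by (rule differentiable_funI[OF differentiable_atlas_quotient W(5)])
qed

lemma differentiable_map_quotientI:
  assumes F: "differentiable_map M P (F \<circ> q) x"
  shows "differentiable_map N P F (q x)"
  unfolding differentiable_map_def
proof (intro conjI ballI allI impI)
  show "q x \<in> points N" "F (q x) \<in> points P" using F by (auto simp: differentiable_map_def points_quotient)
next
  fix V assume "openin (mtop P) V" "F (q x) \<in> V"
  then obtain U where "openin (mtop M) U" "x \<in> U" "(F \<circ> q) ` U \<subseteq> V"
    using F unfolding differentiable_map_def by (metis comp_apply)
  then have "openin (mtop N) (q ` U)" "q x \<in> q ` U" "F ` q ` U \<subseteq> V"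
    using q_open_image by auto
  then show "\<exists>U. openin (mtop N) U \<and> q x \<in> U \<and> F ` U \<subseteq> V" by blast
next
  fix d assume "d \<in> charts_at P (F (q x))"
  then have "differentiable_fun M (snd d \<circ> (F \<circ> q)) x" using F by (simp add: differentiable_map_def)
  then show "differentiable_fun N (snd d \<circ> F) (q x)"
    by (intro differentiable_fun_quotientI) (simp only: o_assoc)
qed

text \<open>In the charts \<open>c\<close> and \<open>sheet_chart c W\<close> the map \<open>q\<close> is the identity.\<close>

lemma tangent_map_q_in_chart:
  assumes "c \<in> charts_at M x"
  obtains d where "d \<in> charts_at N (q x)"
    and "\<And>u. u \<in> tangent_space M x \<Longrightarrow> tangent_map M N q x u d = u c"
proof -
  obtain W where W: "openin (mtop M) W" "x \<in> W" "W \<subseteq> fst c" "inj_on q W"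
    "sheet_chart c W \<in> charts_at N (q x)" using sheet_chart_at[OF assms] .
  note c = differentiable_fun_chart[OF M assms]
  have "tangent_map M N q x u (sheet_chart c W) = u c" if u: "u \<in> tangent_space M x" for u
  proof -
    have "dfun M (snd (sheet_chart c W) \<circ> q) x = dfun M (snd c) x"
      by (rule differentiable_fun_cong(2)[OF M c W(1,2)]) (simp add: sheet_chart_value[OF W(4)])
    moreover have "dfun M (snd c) x u = u c"
      using dfun_in_chart[OF M c u assms] transition_derivative_self[OF M assms] by simp
    ultimately show ?thesis using W(5) by (simp add: tangent_map_def)
  qed
  then show thesis using that W(5) by blast
qed

lemma tangent_map_q_inject:
  assumes "x \<in> points M" and "u \<in> tangent_space M x" and "v \<in> tangent_space M x"
    and "tangent_map M N q x u = tangent_map M N q x v"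
  shows "u = v"
proof -
  obtain c where c: "c \<in> charts_at M x" using charts_at_nonempty[OF M assms(1)] .
  obtain d where "\<And>u. u \<in> tangent_space M x \<Longrightarrow> tangent_map M N q x u d = u c"
    using tangent_map_q_in_chart[OF c] by metis
  then have "u c = v c" using assms(2-4) by metis
  then show ?thesis using tangent_vec_eqI[OF assms(2,3) c] by blast
qed

lemma tangent_map_q_surj:
  assumes "x \<in> points M" and "v \<in> tangent_space N (q x)"
  obtains u where "u \<in> tangent_space M x" and "v = tangent_map M N q x u"
proof -
  obtain c where c: "c \<in> charts_at M x" using charts_at_nonempty[OF M assms(1)] .
  obtain d where d: "d \<in> charts_at N (q x)"
    "\<And>u. u \<in> tangent_space M x \<Longrightarrow> tangent_map M N q x u d = u c"
    using tangent_map_q_in_chart[OF c] by blast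
  note u = coord_vec_in_tangent_space[OF M c, of "v d"]
  have "v = tangent_map M N q x (coord_vec M c x (v d))"
    using tangent_vec_eqI[OF assms(2) tangent_map_in_tangent_space[OF M differentiable_atlas_quotient
          differentiable_map_q[OF assms(1)]] d(1)] d(2)[OF u(1)] u(2) by metis
  then show thesis using that u(1) by blast
qed

lemma tangent_map_q_deck:
  assumes "\<gamma> \<in> \<Gamma>" and "x \<in> points M"
  shows "tangent_map M N q (\<gamma> x) (tangent_map M M \<gamma> x u) = tangent_map M N q x u"
proof -
  have "tangent_map M N (q \<circ> \<gamma>) x u = tangent_map M N q (\<gamma> x) (tangent_map M M \<gamma> x u)"
    by (rule tangent_map_comp(2)[OF M M deck_differentiable[OF assms]
          differentiable_map_q[OF deck_in_points[OF assms]]])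
  moreover have "tangent_map M N (q \<circ> \<gamma>) x = tangent_map M N q x"
    by (rule differentiable_map_cong(2)[OF M differentiable_map_q[OF assms(2)] openin_topspace assms(2)])
       (simp add: q_deck[OF assms(1)])
  ultimately show ?thesis by simp
qed

text \<open>Two lifts of the same point and tangent vectors differ by a deck transformation, because \<open>q\<close> is
  injective on tangent spaces; the invariance of \<open>\<tau>\<close> therefore makes its value independent of the lift.\<close>

lemma descend2_eq:
  assumes inv: "\<And>\<gamma> x u v. \<gamma> \<in> \<Gamma> \<Longrightarrow> x \<in> points M \<Longrightarrow> u \<in> tangent_space M x \<Longrightarrow>
      v \<in> tangent_space M x \<Longrightarrow> \<tau> (\<gamma> x) (tangent_map M M \<gamma> x u) (tangent_map M M \<gamma> x v) = \<tau> x u v"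
    and x: "x \<in> points M" and u: "u \<in> tangent_space M x" and v: "v \<in> tangent_space M x"
  shows "descend2 M q \<tau> (q x) (tangent_map M N q x u) (tangent_map M N q x v) = \<tau> x u v"
  unfolding descend2_def
proof (rule the_equality)
  show "\<exists>p\<in>points M. q p = q x \<and> (\<exists>u'\<in>tangent_space M p. \<exists>v'\<in>tangent_space M p.
      tangent_map M N q p u' = tangent_map M N q x u \<and>
      tangent_map M N q p v' = tangent_map M N q x v \<and> \<tau> x u v = \<tau> p u' v')"
    using x u v by blast
next
  fix r
  assume "\<exists>p\<in>points M. q p = q x \<and> (\<exists>u'\<in>tangent_space M p. \<exists>v'\<in>tangent_space M p.
      tangent_map M N q p u' = tangent_map M N q x u \<and>
      tangent_map M N q p v' = tangent_map M N q x v \<and> r = \<tau> p u' v')"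
  then obtain p u' v' where p: "p \<in> points M" "q p = q x"
    and u': "u' \<in> tangent_space M p" "tangent_map M N q p u' = tangent_map M N q x u"
    and v': "v' \<in> tangent_space M p" "tangent_map M N q p v' = tangent_map M N q x v"
    and r: "r = \<tau> p u' v'" by blast
  obtain \<gamma> where g: "\<gamma> \<in> \<Gamma>" "p = \<gamma> x" using fibre[OF x p(1)] p(2) by metis
  note T = tangent_map_in_tangent_space[OF M M deck_differentiable[OF g(1) x]]
  have "u' = tangent_map M M \<gamma> x u"
    using tangent_map_q_inject[OF p(1) u'(1)] T u'(2) tangent_map_q_deck[OF g(1) x] g(2) by metis
  moreover have "v' = tangent_map M M \<gamma> x v"
    using tangent_map_q_inject[OF p(1) v'(1)] T v'(2) tangent_map_q_deck[OF g(1) x] g(2) by metis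
  ultimately show "r = \<tau> x u v" using inv[OF g(1) x u v] r g(2) by simp
qed

end

section \<open>The circle\<close>

abbreviation circle_class :: "real \<Rightarrow> real set" where
  "circle_class t \<equiv> {t + of_int k |k. True}"

abbreviation translation :: "real \<Rightarrow> real \<Rightarrow> real" where
  "translation a \<equiv> (\<lambda>t. t + a)"

lemma differentiable_map_translation: "differentiable_map model_manifold model_manifold (translation a) t"
proof (rule differentiable_mapI[OF differentiable_atlas_model_manifold])
  show "t \<in> points model_manifold" by (simp add: points_model_manifold)
  show "continuous_map (mtop model_manifold) (mtop model_manifold) (translation a)"
    by (auto simp: model_manifold_def intro!: continuous_intros)
  fix d :: "(real, real) chart" assume "d \<in> charts_at model_manifold (translation a t)"
  then show "differentiable_fun model_manifold (snd d \<circ> translation a) t"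
    by (simp add: charts_at_model_manifold differentiable_fun_model_manifold)
qed

lemma circle_class_eq_iff: "circle_class s = circle_class t \<longleftrightarrow> (\<exists>k. t = s + of_int k)"
proof
  assume "circle_class s = circle_class t"
  moreover have "t \<in> circle_class t" by (auto intro: exI[of _ 0])
  ultimately show "\<exists>k. t = s + of_int k" by blast
next
  assume "\<exists>k. t = s + of_int k"
  then obtain k where k: "t = s + of_int k" ..
  have "s + of_int j = t + of_int (j - k)" "t + of_int j = s + of_int (j + k)" for j
    using k by simp_all
  then show "circle_class s = circle_class t" by blast
qed

interpretation circ: deck_quotient model_manifold circle_class "range (\<lambda>k::int. translation (of_int k))"
proof (unfold_locales, goal_cases)
  case 1
  show ?case by (rule differentiable_atlas_model_manifold)
next
  case (2 \<gamma>)
  then show ?case by (auto simp: model_manifold_def intro!: continuous_intros)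
next
  case (3 \<gamma> t)
  then show ?case using differentiable_map_translation by blast
next
  case (4 s t)
  show ?case unfolding circle_class_eq_iff by simp
next
  case (5 t)
  have "inj_on circle_class {t - 1/2<..<t + 1/2}"
  proof (rule inj_onI)
    fix r s assume r: "r \<in> {t - 1/2<..<t + 1/2}" and s: "s \<in> {t - 1/2<..<t + 1/2}"
      and "circle_class r = circle_class s"
    then obtain k where k: "s = r + of_int k" unfolding circle_class_eq_iff by blast
    \<comment> \<open>both points lie in an interval of length 1\<close>
    then have "\<bar>of_int k :: real\<bar> < 1" using r s by (simp add: abs_less_iff)
    then have "k = 0" by linarith
    then show "r = s" using k by simp
  qed
  then show ?case
    by (intro exI[of _ "{t - 1/2<..<t + 1/2}"]) (simp add: model_manifold_def)
qed

lemma circle_eq: "circle = quotient_manifold model_manifold circle_class"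
  by (simp add: circle_def)

text \<open>Every chart of the circle pulls back to the line as a translation near each point.\<close>

lemma circle_chart_derivative:
  assumes "e \<in> charts_at circle (circle_class t)"
  shows "frechet_derivative (snd e \<circ> circle_class) (at t) = (\<lambda>x. x)"
proof -
  have t: "t \<in> points model_manifold" by (simp add: points_model_manifold)
  obtain c W \<gamma> where c: "c \<in> atlas model_manifold" and W: "openin (mtop model_manifold) W"
    "inj_on circle_class W" and e: "e = circ.sheet_chart c W"
    and g: "\<gamma> \<in> range (\<lambda>k::int. translation (of_int k))" "\<gamma> t \<in> W"
    by (rule circ.charts_at_quotientE[OF t assms[unfolded circle_eq]])
  have c: "snd c = id" using c by (simp add: model_manifold_def)
  obtain k :: int where k: "\<gamma> = translation (of_int k)" using g(1) by blast
  have "open W" using W(1) by (simp add: model_manifold_def)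
  then have "open ((\<lambda>s. s + of_int k) -` W)"
    by (rule open_vimage) (rule continuous_on_add[OF continuous_on_id continuous_on_const])
  then have "open {s. s + of_int k \<in> W}" by (simp add: vimage_def)
  moreover have "t \<in> {s. s + of_int k \<in> W}" using g(2) k by simp
  moreover have "s + of_int k = (snd e \<circ> circle_class) s" if "s \<in> {s. s + of_int k \<in> W}" for s
  proof -
    have "circle_class s = circle_class (s + of_int k)" unfolding circle_class_eq_iff by blast
    then show ?thesis
      using circ.sheet_chart_value[OF W(2), of "s + of_int k" c] that e c by simp
  qed
  ultimately have "\<forall>\<^sub>F s in nhds t. s + of_int k = (snd e \<circ> circle_class) s"
    unfolding eventually_nhds by blast
  then have "frechet_derivative (snd e \<circ> circle_class) (at t) =
      frechet_derivative (\<lambda>s. s + of_int k) (at t)"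
    by (rule differentiable_cong_nhds(2)) simp
  also have "\<dots> = (\<lambda>x. x)"
    by (rule frechet_derivative_at[symmetric]) (auto intro!: derivative_eq_intros)
  finally show ?thesis .
qed

section \<open>The mapping torus\<close>

locale mapping_torus_of_diffeomorphism =
  fixes S :: "('a, 'e::real_normed_vector) manifold" and f :: "'a \<Rightarrow> 'a"
  assumes S: "differentiable_atlas S" and diffeo: "diffeomorphism S S f"
begin

abbreviation F :: "int \<Rightarrow> 'a \<Rightarrow> 'a" where "F \<equiv> int_iterate (points S) f"
abbreviation C where "C \<equiv> cylinder S"
abbreviation q where "q \<equiv> torus_class (points S) f"
abbreviation T where "T \<equiv> mapping_torus S f"

lemma bij: "bij_betw f (points S) (points S)"
  using diffeo by (simp add: diffeomorphism_def)

lemma f_in_points: "p \<in> points S \<Longrightarrow> f p \<in> points S"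
  using bij by (auto simp: bij_betw_def)

lemma inv_in_points: "p \<in> points S \<Longrightarrow> inv_into (points S) f p \<in> points S"
  using bij_betw_inv_into[OF bij] by (auto simp: bij_betw_def)

lemma f_inv: "p \<in> points S \<Longrightarrow> f (inv_into (points S) f p) = p"
  using bij by (simp add: bij_betw_inv_into_right)

lemma F_0: "F 0 p = p"
  by (simp add: int_iterate_def)

lemma F_in_points: "p \<in> points S \<Longrightarrow> F k p \<in> points S"
proof -
  assume p: "p \<in> points S"
  have "(f ^^ n) p \<in> points S" "(inv_into (points S) f ^^ n) p \<in> points S" for n
    by (induction n) (use p f_in_points inv_in_points in auto)
  then show ?thesis by (simp add: int_iterate_def)
qed

lemma F_Suc:
  assumes p: "p \<in> points S"
  shows "F (k + 1) p = f (F k p)"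
proof (cases "0 \<le> k")
  case True
  then have "nat (k + 1) = Suc (nat k)" by simp
  then show ?thesis using True by (simp add: int_iterate_def)
next
  case False
  then have "nat (- k) = Suc (nat (- (k + 1)))" by simp
  moreover have "F (k + 1) p = (inv_into (points S) f ^^ nat (- (k + 1))) p"
    using False by (cases "k = -1") (simp_all add: int_iterate_def)
  ultimately have "F k p = inv_into (points S) f (F (k + 1) p)"
    using False by (simp add: int_iterate_def)
  then show ?thesis using f_inv[OF F_in_points[OF p]] by simp
qed

lemma F_pred:
  assumes p: "p \<in> points S"
  shows "F (k - 1) p = inv_into (points S) f (F k p)"
proof -
  have "F k p = f (F (k - 1) p)" using F_Suc[OF p, of "k - 1"] by simp
  then show ?thesis using bij_betw_inv_into_left[OF bij F_in_points[OF p]] by simp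
qed

lemma F_add:
  assumes p: "p \<in> points S"
  shows "F (j + k) p = F j (F k p)"
proof (induction j rule: int_induct[where k = 0])
  case base
  show ?case by (simp add: F_0)
next
  case (step1 j)
  have "F (j + 1 + k) p = F (j + k + 1) p" by (simp add: algebra_simps)
  then show ?case using step1 F_Suc[OF p] F_Suc[OF F_in_points[OF p]] by simp
next
  case (step2 j)
  have "F (j - 1 + k) p = F (j + k - 1) p" by (simp add: algebra_simps)
  then show ?case using step2 F_pred[OF p] F_pred[OF F_in_points[OF p]] by simp
qed

text \<open>With \<open>g\<close> the action of a group element, this is what lets the action descend to the mapping torus.\<close>

lemma F_commute:
  assumes g: "\<And>p. p \<in> points S \<Longrightarrow> g p \<in> points S" "\<And>p. p \<in> points S \<Longrightarrow> f (g p) = g (f p)"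
    and p: "p \<in> points S"
  shows "F k (g p) = g (F k p)"
proof (induction k rule: int_induct[where k = 0])
  case base
  show ?case by (simp add: F_0)
next
  case (step1 k)
  then show ?case using F_Suc p g F_in_points[OF p] by simp
next
  case (step2 k)
  have "f (g (F (k - 1) p)) = F k (g p)"
    using g(2)[OF F_in_points[OF p]] F_Suc[OF p, of "k - 1"] step2 by simp
  then have "g (F (k - 1) p) = inv_into (points S) f (F k (g p))"
    using bij_betw_inv_into_left[OF bij g(1)[OF F_in_points[OF p]]] by metis
  then show ?case using F_pred[OF g(1)[OF p]] by simp
qed

lemma F_continuous: "continuous_map (mtop S) (mtop S) (F k)"
proof (induction k rule: int_induct[where k = 0])
  case base
  show ?case by (rule continuous_map_eq[OF continuous_map_id]) (simp add: F_0)
next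
  case (step1 k)
  have "continuous_map (mtop S) (mtop S) f" using diffeo by (simp add: diffeomorphism_def smooth_map_def)
  from continuous_map_compose[OF step1(2) this] show ?case
    by (rule continuous_map_eq) (simp add: F_Suc)
next
  case (step2 k)
  have "continuous_map (mtop S) (mtop S) (inv_into (points S) f)"
    using diffeo by (simp add: diffeomorphism_def smooth_map_def)
  from continuous_map_compose[OF step2(2) this] show ?case
    by (rule continuous_map_eq) (simp add: F_pred)
qed

lemma f_differentiable: "p \<in> points S \<Longrightarrow> differentiable_map S S f p"
  using diffeo smooth_map_imp_differentiable_map[OF S] by (auto simp: diffeomorphism_def)

lemma F_differentiable:
  assumes p: "p \<in> points S"
  shows "differentiable_map S S (F k) p"
proof (induction k rule: int_induct[where k = 0])
  case base
  show ?case
    by (rule differentiable_map_cong(1)[OF S tangent_map_ident(1)[OF S p] openin_topspace p])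
       (simp add: F_0)
next
  case (step1 k)
  note d = tangent_map_comp(1)[OF S S step1(2) f_differentiable[OF F_in_points[OF p]]]
  show ?case
    by (rule differentiable_map_cong(1)[OF S d openin_topspace p]) (simp add: F_Suc)
next
  case (step2 k)
  have "differentiable_map S S (inv_into (points S) f) (F k p)"
    using diffeo smooth_map_imp_differentiable_map[OF S _ F_in_points[OF p]]
    by (auto simp: diffeomorphism_def)
  note d = tangent_map_comp(1)[OF S S step2(2) this]
  show ?case
    by (rule differentiable_map_cong(1)[OF S d openin_topspace p]) (simp add: F_pred)
qed

lemma tangent_map_F_Suc:
  assumes p: "p \<in> points S"
  shows "tangent_map S S (F (k + 1)) p v = tangent_map S S f (F k p) (tangent_map S S (F k) p v)"
proof -
  note d = tangent_map_comp[OF S S F_differentiable[OF p] f_differentiable[OF F_in_points[OF p]]]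
  have "tangent_map S S (F (k + 1)) p = tangent_map S S (f \<circ> F k) p"
    by (rule differentiable_map_cong(2)[OF S d(1) openin_topspace p]) (simp add: F_Suc)
  then show ?thesis using d(2) by simp
qed

text \<open>The integer \<open>k\<close> acts on \<open>S \<times> \<real>\<close> by \<open>deck k\<close>; the mapping torus is the quotient by this action.\<close>

definition deck :: "int \<Rightarrow> 'a \<times> real \<Rightarrow> 'a \<times> real" where
  "deck k z = (F k (fst z), snd z + of_int k)"

lemma q_eq: "q z = {deck k z |k. True}"
  by (cases z) (simp add: torus_class_def deck_def)

lemma points_C: "points C = points S \<times> UNIV"
  by (simp add: cylinder_def points_prod_manifold points_model_manifold)

lemma deck_add: "z \<in> points C \<Longrightarrow> deck j (deck k z) = deck (j + k) z"
  by (auto simp: deck_def F_add points_C)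

lemma deck_0: "deck 0 z = z"
  by (simp add: deck_def F_0)

lemma q_eq_iff:
  assumes "z \<in> points C"
  shows "q z = q w \<longleftrightarrow> (\<exists>k. w = deck k z)"
proof
  assume eq: "q z = q w"
  have "w = deck 0 w" by (simp add: deck_0)
  then have "w \<in> q w" unfolding q_eq by blast
  then have "w \<in> q z" by (simp only: eq)
  then show "\<exists>k. w = deck k z" unfolding q_eq by blast
next
  assume "\<exists>k. w = deck k z"
  then obtain k where w: "w = deck k z" ..
  have "deck j z = deck (j - k) w" "deck j w = deck (j + k) z" for j
    using deck_add[OF assms] w by simp_all
  then show "q z = q w" unfolding q_eq by blast
qed

lemma C_atlas: "differentiable_atlas C"
  unfolding cylinder_def by (rule differentiable_atlas_prod[OF S differentiable_atlas_model_manifold])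

lemmas fst_differentiable =
  differentiable_map_fst(1)[OF S differentiable_atlas_model_manifold, where 'd = real, folded cylinder_def]
lemmas snd_differentiable =
  differentiable_map_snd(1)[OF S differentiable_atlas_model_manifold, where 'd = real, folded cylinder_def]

lemma deck_continuous_map: "continuous_map (mtop C) (mtop C) (deck k)"
proof -
  have C: "mtop C = prod_topology (mtop S) euclideanreal"
    by (simp add: cylinder_def prod_manifold_def model_manifold_def)
  have "continuous_map (mtop C) (mtop S) (F k \<circ> fst)"
    unfolding C by (rule continuous_map_compose[OF continuous_map_fst F_continuous])
  moreover have "continuous_map (mtop C) euclideanreal (translation (of_int k) \<circ> snd)"
    unfolding C by (rule continuous_map_compose[OF continuous_map_snd]) (auto intro!: continuous_intros)
  ultimately have "continuous_map (mtop C) (prod_topology (mtop S) euclideanreal)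
      (\<lambda>z. ((F k \<circ> fst) z, (translation (of_int k) \<circ> snd) z))"
    by (rule continuous_map_pairedI)
  then show ?thesis by (simp add: deck_def[abs_def] C)
qed

lemma deck_differentiable_map:
  assumes z: "z \<in> points C"
  shows "differentiable_map C C (deck k) z"
proof -
  have p: "fst z \<in> points S" using z by (auto simp: points_C)
  have "differentiable_map C (prod_manifold S model_manifold)
      (\<lambda>z. ((F k \<circ> fst) z, (translation (of_int k) \<circ> snd) z)) z"
    by (rule differentiable_map_Pair[OF C_atlas
          tangent_map_comp(1)[OF C_atlas S fst_differentiable[OF z] F_differentiable[OF p]]
          tangent_map_comp(1)[OF C_atlas differentiable_atlas_model_manifold
            snd_differentiable[OF z] differentiable_map_translation]])
  then show ?thesis by (simp add: deck_def[abs_def] cylinder_def)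
qed

sublocale tor: deck_quotient C q "range deck"
proof (unfold_locales, goal_cases)
  case 1
  show ?case by (rule C_atlas)
next
  case (2 \<gamma>)
  then show ?case using deck_continuous_map by blast
next
  case (3 \<gamma> z)
  then show ?case using deck_differentiable_map by blast
next
  case (4 z w)
  then show ?case using q_eq_iff by blast
next
  case (5 z)
  let ?W = "points S \<times> {snd z - 1/2<..<snd z + 1/2}"
  have W: "openin (mtop C) ?W"
    by (simp add: cylinder_def prod_manifold_def model_manifold_def openin_prod_Times_iff)
  have "inj_on q ?W"
  proof (rule inj_onI)
    fix x y assume x: "x \<in> ?W" and y: "y \<in> ?W" and "q x = q y"
    moreover have "x \<in> points C" using x by (auto simp: points_C)
    ultimately obtain k where k: "y = deck k x" using q_eq_iff by blast
    then have "\<bar>of_int k :: real\<bar> < 1" using x y by (auto simp: deck_def abs_less_iff)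
    then have "k = 0" by linarith
    then show "x = y" using k deck_0 by simp
  qed
  moreover have "z \<in> ?W" using 5 by (cases z) (simp add: points_C)
  ultimately show ?case using W by blast
qed

lemma T_eq: "T = quotient_manifold C q"
  by (simp add: mapping_torus_def)

lemma T_atlas: "differentiable_atlas T"
  unfolding T_eq by (rule tor.differentiable_atlas_quotient)

lemma q_differentiable: "z \<in> points C \<Longrightarrow> differentiable_map C T q z"
  unfolding T_eq by (rule tor.differentiable_map_q)

lemma points_T: "points T = q ` points C"
  unfolding T_eq by (rule tor.points_quotient)

lemma torus_proj_q: "torus_proj (q z) = circle_class (snd z)"
  by (auto simp: torus_proj_def q_eq deck_def image_def)

text \<open>The projection to the circle lifts to \<open>snd\<close> on \<open>S \<times> \<real>\<close>, and \<open>d\<theta>\<close> pulls back to \<open>dt\<close> on the line.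
  Hence \<open>\<eta>\<close> pulls back to \<open>dt\<close>.\<close>

lemma torus_eta_q:
  assumes z: "z \<in> points C"
  shows "torus_eta S f (q z) (tangent_map C T q z w) = dfun C snd z w"
proof -
  have e: "torus_proj \<circ> q = circle_class \<circ> snd" by (rule ext) (simp add: torus_proj_q)
  have cl: "differentiable_map model_manifold circle circle_class t" for t
    unfolding circle_eq by (rule circ.differentiable_map_q) (simp add: points_model_manifold)
  have atc: "differentiable_atlas circle" unfolding circle_eq by (rule circ.differentiable_atlas_quotient)
  note s = tangent_map_comp[OF C_atlas differentiable_atlas_model_manifold snd_differentiable[OF z] cl]
  have "differentiable_map C circle (torus_proj \<circ> q) z" unfolding e by (rule s(1))
  then have p: "differentiable_map T circle torus_proj (q z)"
    unfolding T_eq by (rule tor.differentiable_map_quotientI)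
  have "tangent_map T circle torus_proj (q z) (tangent_map C T q z w) =
      tangent_map C circle (torus_proj \<circ> q) z w"
    by (rule tangent_map_comp(2)[OF C_atlas T_atlas q_differentiable[OF z] p, symmetric])
  also have "\<dots> = tangent_map model_manifold circle circle_class (snd z)
      (tangent_map C model_manifold snd z w)"
    unfolding e by (rule s(2))
  finally have t: "tangent_map T circle torus_proj (q z) (tangent_map C T q z w) =
    tangent_map model_manifold circle circle_class (snd z) (tangent_map C model_manifold snd z w)" .
  have "circle_class (snd z) \<in> points circle"
    using cl[of "snd z"] by (simp add: differentiable_map_def)
  then have c: "some_chart circle (circle_class (snd z)) \<in> charts_at circle (circle_class (snd z))"
    by (rule some_chart_in_charts_at[OF atc])
  show ?thesis
    unfolding torus_eta_def t circle_dtheta_def torus_proj_q tangent_map_def[of model_manifold]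
    using c circle_chart_derivative[OF c]
    by (simp add: dfun_model_manifold tangent_map_model_manifold)
qed

text \<open>
  The tangent space of \<open>S \<times> \<real>\<close> at \<open>(p, t)\<close> is spanned by the image of the tangent space of \<open>S\<close> at \<open>p\<close>
  under the inclusion of the slice \<open>S \<times> {t}\<close>, and by the vector \<open>vertical p t\<close>, which is \<open>\<partial>/\<partial>t\<close>.
\<close>

lemma horizontal_lift:
  assumes p: "p \<in> points S"
  shows "differentiable_map S C (\<lambda>x. (x, t)) p"
    and "v \<in> tangent_space S p \<Longrightarrow> tangent_map C S fst (p, t) (tangent_map S C (\<lambda>x. (x, t)) p v) = v"
    and "dfun C snd (p, t) (tangent_map S C (\<lambda>x. (x, t)) p v) = 0"
proof -
  have t: "t \<in> points model_manifold" by (simp add: points_model_manifold)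
  note s = tangent_map_prod_slice[OF S differentiable_atlas_model_manifold p t, folded cylinder_def]
  show "differentiable_map S C (\<lambda>x. (x, t)) p" by (rule s(1))
  show "tangent_map C S fst (p, t) (tangent_map S C (\<lambda>x. (x, t)) p v) = v" if "v \<in> tangent_space S p"
    using s(2) that by blast
  show "dfun C snd (p, t) (tangent_map S C (\<lambda>x. (x, t)) p v) = 0"
    using fun_cong[OF s(3)[of v], of "(UNIV, id)"] by (simp add: tangent_map_model_manifold)
qed

definition vertical :: "'a \<Rightarrow> real \<Rightarrow> ('a \<times> real, 'e \<times> real) tvec" where
  "vertical p t = tangent_map model_manifold C (\<lambda>s. (p, s)) t (coord_vec model_manifold (UNIV, id) t 1)"

lemma vertical_lift:
  assumes p: "p \<in> points S"
  shows "differentiable_map model_manifold C (\<lambda>s. (p, s)) t"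
    and "vertical p t \<in> tangent_space C (p, t)"
    and "tangent_map C S fst (p, t) (vertical p t) = (\<lambda>_. 0)"
    and "dfun C snd (p, t) (vertical p t) = 1"
proof -
  let ?R = "model_manifold :: (real, real) manifold"
  have t: "t \<in> points ?R" by (simp add: points_model_manifold)
  have c: "(UNIV, id) \<in> charts_at ?R t" by (simp add: charts_at_model_manifold)
  note R = differentiable_atlas_model_manifold
  have z: "(p, t) \<in> points C" using p by (simp add: points_C)
  show d: "differentiable_map ?R C (\<lambda>s. (p, s)) t"
    unfolding cylinder_def
    by (rule differentiable_map_Pair[OF R differentiable_map_const(1)[OF R t p] tangent_map_ident(1)[OF R t]])
  show "vertical p t \<in> tangent_space C (p, t)"
    unfolding vertical_def by (rule tangent_map_in_tangent_space[OF R C_atlas d])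
  show "tangent_map C S fst (p, t) (vertical p t) = (\<lambda>_. 0)"
    using tangent_map_comp(2)[OF R C_atlas d fst_differentiable[OF z]]
      differentiable_map_const(2)[OF R t p]
    by (simp add: comp_def vertical_def)
  show "dfun C snd (p, t) (vertical p t) = 1"
    using dfun_comp(2)[OF R C_atlas d differentiable_map_model_manifold[OF snd_differentiable[OF z]]]
      coord_vec_in_tangent_space(2)[OF R c]
    by (simp add: comp_def vertical_def dfun_model_manifold)
qed

end

section \<open>The cosymplectic structure of the mapping torus\<close>

text \<open>The properties of the fundamental form of a Kaehler manifold that determine the cosymplectic structure
  of the mapping torus.\<close>

locale mapping_torus_of_symplectomorphism = mapping_torus_of_diffeomorphism S f
  for S :: "('a, 'e::real_normed_vector) manifold" and f +
  fixes \<Omega> :: "('a, 'e) two_tensor"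
  assumes invariant: "p \<in> points S \<Longrightarrow> u \<in> tangent_space S p \<Longrightarrow> v \<in> tangent_space S p \<Longrightarrow>
      \<Omega> (f p) (tangent_map S S f p u) (tangent_map S S f p v) = \<Omega> p u v"
    and zero_left: "p \<in> points S \<Longrightarrow> v \<in> tangent_space S p \<Longrightarrow> \<Omega> p (\<lambda>_. 0) v = 0"
    and nondegenerate: "p \<in> points S \<Longrightarrow> u \<in> tangent_space S p \<Longrightarrow>
      (\<And>v. v \<in> tangent_space S p \<Longrightarrow> \<Omega> p u v = 0) \<Longrightarrow> u = (\<lambda>_. 0)"
begin

lemma invariant_F:
  assumes p: "p \<in> points S" and u: "u \<in> tangent_space S p" and v: "v \<in> tangent_space S p"
  shows "\<Omega> (F k p) (tangent_map S S (F k) p u) (tangent_map S S (F k) p v) = \<Omega> p u v"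
proof -
  have T: "tangent_map S S (F k) p w \<in> tangent_space S (F k p)" for w k
    by (rule tangent_map_in_tangent_space[OF S S F_differentiable[OF p]])
  have step: "\<Omega> (F (k + 1) p) (tangent_map S S (F (k + 1)) p u) (tangent_map S S (F (k + 1)) p v) =
      \<Omega> (F k p) (tangent_map S S (F k) p u) (tangent_map S S (F k) p v)" for k
    unfolding tangent_map_F_Suc[OF p] F_Suc[OF p] by (rule invariant[OF F_in_points[OF p] T T])
  show ?thesis
  proof (induction k rule: int_induct[where k = 0])
    case base
    have "tangent_map S S (F 0) p = tangent_map S S (\<lambda>x. x) p"
      by (rule differentiable_map_cong(2)[OF S tangent_map_ident(1)[OF S p] openin_topspace p])
         (simp add: F_0)
    then show ?case using tangent_map_ident(2)[OF S p] u v by (simp add: F_0)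
  next
    case (step1 k)
    then show ?case using step[of k] by simp
  next
    case (step2 k)
    then show ?case using step[of "k - 1"] by simp
  qed
qed

abbreviation \<eta> where "\<eta> \<equiv> torus_eta S f"
abbreviation \<omega> where "\<omega> \<equiv> torus_omega S f \<Omega>"

lemma fst_tangent: "z \<in> points C \<Longrightarrow> tangent_map C S fst z w \<in> tangent_space S (fst z)"
  by (rule tangent_map_in_tangent_space[OF C_atlas S fst_differentiable])

text \<open>Deck transformations cover iterates of \<open>f\<close>, which preserve \<open>\<Omega>\<close>; so the pullback of \<open>\<Omega>\<close> to \<open>S \<times> \<real>\<close>
  descends.\<close>

lemma torus_omega_q:
  assumes z: "z \<in> points C" and u: "u \<in> tangent_space C z" and v: "v \<in> tangent_space C z"
  shows "\<omega> (q z) (tangent_map C T q z u) (tangent_map C T q z v) =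
    \<Omega> (fst z) (tangent_map C S fst z u) (tangent_map C S fst z v)"
proof -
  have "pullback2 C S fst \<Omega> (\<gamma> x) (tangent_map C C \<gamma> x u) (tangent_map C C \<gamma> x v) =
      pullback2 C S fst \<Omega> x u v"
    if g: "\<gamma> \<in> range deck" and x: "x \<in> points C" for \<gamma> x u v
  proof -
    obtain k where k: "\<gamma> = deck k" using g by blast
    have p: "fst x \<in> points S" using x by (auto simp: points_C)
    have dx: "deck k x \<in> points C" using tor.deck_in_points[OF _ x] by blast
    have e: "fst \<circ> deck k = F k \<circ> fst" by (auto simp: deck_def)
    have "tangent_map C S fst (deck k x) (tangent_map C C (deck k) x w) =
        tangent_map S S (F k) (fst x) (tangent_map C S fst x w)" for w
      using tangent_map_comp(2)[OF C_atlas C_atlas deck_differentiable_map[OF x] fst_differentiable[OF dx], of w]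
        tangent_map_comp(2)[OF C_atlas S fst_differentiable[OF x] F_differentiable[OF p], of k w]
      unfolding e by simp
    then show ?thesis
      using invariant_F[OF p fst_tangent[OF x] fst_tangent[OF x]]
      by (simp add: k pullback2_def deck_def)
  qed
  then show ?thesis
    using tor.descend2_eq[of "pullback2 C S fst \<Omega>", OF _ z u v]
    unfolding torus_omega_def T_eq by (simp add: pullback2_def)
qed

text \<open>A vector in the kernel of \<open>\<omega>\<close> lifts to a vector whose component along \<open>S\<close> is zero, since \<open>\<Omega>\<close> is
  nondegenerate. If \<open>\<eta>\<close> is \<open>1\<close> on it, then its component along \<open>\<real>\<close> is \<open>1\<close>.\<close>

lemma reeb_field_torus:
  assumes p: "p \<in> points S"
  shows "reeb_field T \<eta> \<omega> (q (p, t)) = tangent_map C T q (p, t) (vertical p t)"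
  unfolding reeb_field_def
proof (rule the_equality)
  let ?z = "(p, t)"
  have z: "?z \<in> points C" using p by (simp add: points_C)
  have surj: "\<exists>u\<in>tangent_space C ?z. w = tangent_map C T q ?z u" if "w \<in> tangent_space T (q ?z)" for w
    using tor.tangent_map_q_surj[OF z] that unfolding T_eq by metis
  note vert = vertical_lift[OF p, of t]
  show "tangent_map C T q ?z (vertical p t) \<in> tangent_space T (q ?z) \<and>
      (\<forall>w\<in>tangent_space T (q ?z). \<omega> (q ?z) (tangent_map C T q ?z (vertical p t)) w = 0) \<and>
      \<eta> (q ?z) (tangent_map C T q ?z (vertical p t)) = 1"
  proof (intro conjI ballI)
    show "tangent_map C T q ?z (vertical p t) \<in> tangent_space T (q ?z)"
      by (rule tangent_map_in_tangent_space[OF C_atlas T_atlas q_differentiable[OF z]])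
    show "\<eta> (q ?z) (tangent_map C T q ?z (vertical p t)) = 1"
      using torus_eta_q[OF z] vert(4) by simp
    fix w assume "w \<in> tangent_space T (q ?z)"
    then obtain u where u: "u \<in> tangent_space C ?z" "w = tangent_map C T q ?z u" using surj by blast
    show "\<omega> (q ?z) (tangent_map C T q ?z (vertical p t)) w = 0"
      using torus_omega_q[OF z vert(2) u(1)] vert(3) zero_left[OF p] fst_tangent[OF z] u(2) by simp
  qed
  fix v assume v: "v \<in> tangent_space T (q ?z) \<and>
      (\<forall>w\<in>tangent_space T (q ?z). \<omega> (q ?z) v w = 0) \<and> \<eta> (q ?z) v = 1"
  then obtain u where u: "u \<in> tangent_space C ?z" "v = tangent_map C T q ?z u" using surj by blast
  have "tangent_map C S fst ?z u = (\<lambda>_. 0)"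
  proof (rule nondegenerate[OF p])
    show "tangent_map C S fst ?z u \<in> tangent_space S p" using fst_tangent[OF z] by simp
    fix b assume b: "b \<in> tangent_space S p"
    let ?h = "tangent_map S C (\<lambda>x. (x, t)) p b"
    have h: "?h \<in> tangent_space C ?z"
      by (rule tangent_map_in_tangent_space[OF S C_atlas horizontal_lift(1)[OF p]])
    have "\<omega> (q ?z) v (tangent_map C T q ?z ?h) = 0"
      using v tangent_map_in_tangent_space[OF C_atlas T_atlas q_differentiable[OF z]] by blast
    then show "\<Omega> p (tangent_map C S fst ?z u) b = 0"
      using torus_omega_q[OF z u(1) h] horizontal_lift(2)[OF p b] u(2) by simp
  qed
  then have "tangent_map C S fst ?z u = tangent_map C S fst ?z (vertical p t)"
    using vert(3) by simp
  moreover have "dfun C snd ?z u = 1" using v u(2) torus_eta_q[OF z] by simp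
  then have "tangent_map C model_manifold snd ?z u = tangent_map C model_manifold snd ?z (vertical p t)"
    by (intro ext) (simp add: tangent_map_model_manifold vert(4))
  ultimately have "u = vertical p t"
    using z u(1) vert(2) unfolding cylinder_def
    by (intro prod_tangent_eqI[OF S differentiable_atlas_model_manifold])
  then show "v = tangent_map C T q ?z (vertical p t)" using u(2) by simp
qed

text \<open>The Reeb field lifts to \<open>vertical p t\<close>, the velocity of the curve \<open>s \<mapsto> (p, s)\<close> at \<open>t\<close>.\<close>

lemma dfun_reeb:
  assumes p: "p \<in> points S" and H: "differentiable_fun T H (q (p, t))"
  shows "(\<lambda>s. H (q (p, s))) differentiable at t"
    and "dfun T H (q (p, t)) (reeb_field T \<eta> \<omega> (q (p, t))) =
      frechet_derivative (\<lambda>s. H (q (p, s))) (at t) 1"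
proof -
  let ?R = "model_manifold :: (real, real) manifold"
  have z: "(p, t) \<in> points C" using p by (simp add: points_C)
  note R = differentiable_atlas_model_manifold
  have c: "(UNIV, id) \<in> charts_at ?R t" by (simp add: charts_at_model_manifold)
  note d = dfun_comp[OF C_atlas T_atlas q_differentiable[OF z] H]
  note e = dfun_comp[OF R C_atlas vertical_lift(1)[OF p] d(1)]
  show "(\<lambda>s. H (q (p, s))) differentiable at t"
    using e(1) by (simp add: differentiable_fun_model_manifold comp_def)
  have "dfun T H (q (p, t)) (reeb_field T \<eta> \<omega> (q (p, t))) =
      dfun ?R (H \<circ> q \<circ> (\<lambda>s. (p, s))) t (coord_vec ?R (UNIV, id) t 1)"
    unfolding reeb_field_torus[OF p] vertical_def d(2)[symmetric] e(2) ..
  also have "\<dots> = frechet_derivative (\<lambda>s. H (q (p, s))) (at t) 1"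
    using coord_vec_in_tangent_space(2)[OF R c] by (simp add: dfun_model_manifold comp_def)
  finally show "dfun T H (q (p, t)) (reeb_field T \<eta> \<omega> (q (p, t))) =
      frechet_derivative (\<lambda>s. H (q (p, s))) (at t) 1" .
qed

end

section \<open>The action on the mapping torus\<close>

text \<open>The action enters through its orbit maps near the unit, which define the induced fields, and through
  its commuting with \<open>f\<close>.\<close>

locale mapping_torus_action = mapping_torus_of_symplectomorphism S f \<Omega>
  for S :: "('a, 'e::real_normed_vector) manifold" and f \<Omega> +
  fixes G :: "('g, 'm) monoid_scheme" and GM :: "('g, 'l::real_normed_vector) manifold"
    and \<phi> :: "'g \<Rightarrow> 'a \<Rightarrow> 'a"
  assumes GM: "differentiable_atlas GM" and points_GM: "points GM = carrier G"
    and one: "\<one>\<^bsub>G\<^esub> \<in> carrier G"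
    and action_in_points: "g \<in> carrier G \<Longrightarrow> p \<in> points S \<Longrightarrow> \<phi> g p \<in> points S"
    and orbit_differentiable: "p \<in> points S \<Longrightarrow> differentiable_map GM S (\<lambda>g. \<phi> g p) \<one>\<^bsub>G\<^esub>"
    and action_one: "p \<in> points S \<Longrightarrow> \<phi> \<one>\<^bsub>G\<^esub> p = p"
    and commute: "g \<in> carrier G \<Longrightarrow> p \<in> points S \<Longrightarrow> f (\<phi> g p) = \<phi> g (f p)"
begin

abbreviation act where "act \<equiv> torus_action S f \<phi>"

text \<open>The action on \<open>S\<close> commutes with all iterates of \<open>f\<close>, so it maps each class onto a class.\<close>

lemma torus_action_q:
  assumes g: "g \<in> carrier G" and p: "p \<in> points S"
  shows "act g (q (p, t)) = q (\<phi> g p, t)"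
proof -
  have c: "F k (\<phi> g p) = \<phi> g (F k p)" for k
    by (rule F_commute) (use g p action_in_points commute in auto)
  have "q (p, t) \<in> points T" using p by (simp add: points_T points_C)
  then have "act g (q (p, t)) = (\<lambda>(p, t). (\<phi> g p, t)) ` q (p, t)" by (simp add: torus_action_def)
  also have "\<dots> = q (\<phi> g p, t)" by (auto simp: q_eq deck_def c image_def)
  finally show ?thesis .
qed

text \<open>The orbit map of \<open>q (p, t)\<close> is the orbit map of \<open>p\<close>, followed by the inclusion of the slice
  \<open>S \<times> {t}\<close> and by \<open>q\<close>.\<close>

lemma induced_field_torus:
  assumes p: "p \<in> points S"
  shows "induced_field G GM T act A (q (p, t)) =
    tangent_map C T q (p, t) (tangent_map S C (\<lambda>x. (x, t)) p (induced_field G GM S \<phi> A p))"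
proof -
  have oneGM: "\<one>\<^bsub>G\<^esub> \<in> points GM" using one points_GM by simp
  have z: "(p, t) \<in> points C" using p by (simp add: points_C)
  have h: "differentiable_map S C (\<lambda>x. (x, t)) (\<phi> \<one>\<^bsub>G\<^esub> p)"
    using horizontal_lift(1)[OF p] by (simp add: action_one[OF p])
  note d = tangent_map_comp[OF GM S orbit_differentiable[OF p] h]
  have "differentiable_map C T q (((\<lambda>x. (x, t)) \<circ> (\<lambda>g. \<phi> g p)) \<one>\<^bsub>G\<^esub>)"
    using q_differentiable[OF z] by (simp add: action_one[OF p])
  note e = tangent_map_comp[OF GM C_atlas d(1) this]
  have "tangent_map GM T (\<lambda>g. act g (q (p, t))) \<one>\<^bsub>G\<^esub> =
      tangent_map GM T (q \<circ> ((\<lambda>x. (x, t)) \<circ> (\<lambda>g. \<phi> g p))) \<one>\<^bsub>G\<^esub>"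
    by (rule differentiable_map_cong(2)[OF GM e(1) openin_topspace oneGM])
       (simp add: points_GM torus_action_q[OF _ p])
  then show ?thesis
    using e(2)[of A] unfolding d(2)[of A] by (simp only: comp_def action_one[OF p] induced_field_def)
qed

lemma induced_field_in_tangent_space:
  assumes p: "p \<in> points S"
  shows "induced_field G GM S \<phi> A p \<in> tangent_space S p"
  using tangent_map_in_tangent_space[OF GM S orbit_differentiable[OF p], of A]
  by (simp add: induced_field_def action_one[OF p])

lemma omega_induced_field:
  assumes p: "p \<in> points S" and w: "w \<in> tangent_space C (p, t)"
  shows "\<omega> (q (p, t)) (induced_field G GM T act A (q (p, t))) (tangent_map C T q (p, t) w) =
    \<Omega> p (induced_field G GM S \<phi> A p) (tangent_map C S fst (p, t) w)"
proof -
  let ?h = "tangent_map S C (\<lambda>x. (x, t)) p (induced_field G GM S \<phi> A p)"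
  have z: "(p, t) \<in> points C" using p by (simp add: points_C)
  have h: "?h \<in> tangent_space C (p, t)"
    by (rule tangent_map_in_tangent_space[OF S C_atlas horizontal_lift(1)[OF p]])
  show ?thesis
    unfolding induced_field_torus[OF p] torus_omega_q[OF z h w]
    using horizontal_lift(2)[OF p induced_field_in_tangent_space[OF p]] by simp
qed

lemma eta_induced_field:
  assumes p: "p \<in> points S"
  shows "\<eta> (q (p, t)) (induced_field G GM T act A (q (p, t))) = 0"
  unfolding induced_field_torus[OF p]
  using torus_eta_q horizontal_lift(3)[OF p] p by (simp add: points_C)

section \<open>Moment maps of the mapping torus\<close>

text \<open>The derivative of \<open>\<nu>\<^sup>A\<close> along the Reeb field vanishes, so \<open>\<nu>\<^sup>A\<close> is constant on \<open>{p} \<times> \<real>\<close>.\<close>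

lemma moment_map_constant_vertically:
  assumes \<nu>: "cosymplectic_moment_map G GM T act \<eta> \<omega> \<nu>" and A: "A \<in> lie_algebra G GM"
    and p: "p \<in> points S"
  shows "\<nu> (q (p, s)) A = \<nu> (q (p, t)) A"
proof -
  have "((\<lambda>s. \<nu> (q (p, s)) A) has_real_derivative 0) (at t)" for t
  proof -
    have x: "q (p, t) \<in> points T" using p by (simp add: points_T points_C)
    have "smooth_map T model_manifold (\<lambda>y. \<nu> y A)"
      using \<nu> A by (simp add: cosymplectic_moment_map_def smooth_equivariant_to_dual_def)
    then have "differentiable_fun T (\<lambda>y. \<nu> y A) (q (p, t))"
      by (intro differentiable_map_model_manifold smooth_map_imp_differentiable_map[OF T_atlas _ x])
    note d = dfun_reeb[OF p this]
    let ?D = "frechet_derivative (\<lambda>s. \<nu> (q (p, s)) A) (at t)"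
    have D1: "?D 1 = 0"
      using \<nu> A x d(2) by (simp add: cosymplectic_moment_map_def)
    have "?D r = 0" for r
      using linear_frechet_derivative[OF d(1)] linear_scale[of ?D r 1] D1 by simp
    then have "?D = (\<lambda>r. 0 * r)" by auto
    moreover have "((\<lambda>s. \<nu> (q (p, s)) A) has_derivative ?D) (at t)"
      using d(1) frechet_derivative_works by blast
    ultimately show ?thesis unfolding has_field_derivative_def by (simp only:)
  qed
  then show ?thesis using DERIV_isconst_all by blast
qed

text \<open>The first condition on a cosymplectic moment map, pulled back to a slice \<open>S \<times> {t}\<close>, is the moment map
  equation on \<open>S\<close>: the Reeb term vanishes.\<close>

lemma moment_map_horizontal_derivative:
  assumes \<nu>: "cosymplectic_moment_map G GM T act \<eta> \<omega> \<nu>" and A: "A \<in> lie_algebra G GM"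
    and p: "p \<in> points S"
  shows "differentiable_fun S (\<lambda>x. \<nu> (q (x, t)) A) p"
    and "v \<in> tangent_space S p \<Longrightarrow>
      dfun S (\<lambda>x. \<nu> (q (x, t)) A) p v = \<Omega> p (induced_field G GM S \<phi> A p) v"
proof -
  have z: "(p, t) \<in> points C" using p by (simp add: points_C)
  have x: "q (p, t) \<in> points T" using z by (simp add: points_T)
  have "smooth_map T model_manifold (\<lambda>y. \<nu> y A)"
    using \<nu> A by (simp add: cosymplectic_moment_map_def smooth_equivariant_to_dual_def)
  then have "differentiable_fun T (\<lambda>y. \<nu> y A) (q (p, t))"
    by (intro differentiable_map_model_manifold smooth_map_imp_differentiable_map[OF T_atlas _ x])
  note d = dfun_comp[OF C_atlas T_atlas q_differentiable[OF z] this]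
  note e = dfun_comp[OF S C_atlas horizontal_lift(1)[OF p] d(1)]
  show "differentiable_fun S (\<lambda>x. \<nu> (q (x, t)) A) p"
    using e(1) by (simp add: comp_def)
  assume v: "v \<in> tangent_space S p"
  let ?h = "tangent_map S C (\<lambda>x. (x, t)) p v"
  have h: "?h \<in> tangent_space C (p, t)"
    by (rule tangent_map_in_tangent_space[OF S C_atlas horizontal_lift(1)[OF p]])
  have "dfun S (\<lambda>x. \<nu> (q (x, t)) A) p v = dfun T (\<lambda>y. \<nu> y A) (q (p, t)) (tangent_map C T q (p, t) ?h)"
    using e(2)[of v] d(2)[of ?h] by (simp add: comp_def)
  also have "\<dots> = \<omega> (q (p, t)) (induced_field G GM T act A (q (p, t))) (tangent_map C T q (p, t) ?h)"
    using \<nu> A x tangent_map_in_tangent_space[OF C_atlas T_atlas q_differentiable[OF z]]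
    by (simp add: cosymplectic_moment_map_def)
  also have "\<dots> = \<Omega> p (induced_field G GM S \<phi> A p) v"
    unfolding omega_induced_field[OF p h] horizontal_lift(2)[OF p v] ..
  finally show "dfun S (\<lambda>x. \<nu> (q (x, t)) A) p v = \<Omega> p (induced_field G GM S \<phi> A p) v" .
qed

text \<open>
  An \<open>f\<close>-invariant \<open>\<mu>\<close> is constant on the classes when extended to \<open>S \<times> \<real>\<close> by \<open>(p, t) \<mapsto> \<mu> p\<close>. The
  extension does not depend on \<open>t\<close>, so the Reeb field annihilates it, and on vectors along \<open>S\<close> its
  differential is given by the moment map equation for \<open>\<mu>\<close>.
\<close>

lemma cosymplectic_moment_map_of_invariant:
  assumes \<mu>: "moment_map G GM S \<phi> \<Omega> \<mu>" and inv: "\<And>p. p \<in> points S \<Longrightarrow> \<mu> (f p) = \<mu> p"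
  defines "\<nu> \<equiv> \<lambda>y. \<mu> (fst (inv_into (points C) q y))"
  shows "cosymplectic_moment_map G GM T act \<eta> \<omega> \<nu>"
proof -
  have \<mu>F: "\<mu> (F k p) = \<mu> p" if p: "p \<in> points S" for k p
  proof (induction k rule: int_induct[where k = 0])
    case base
    show ?case by (simp add: F_0)
  next
    case (step1 k)
    then show ?case using inv[OF F_in_points[OF p]] F_Suc[OF p] by simp
  next
    case (step2 k)
    then show ?case using inv[OF F_in_points[OF p, of "k - 1"]] F_Suc[OF p, of "k - 1"] by simp
  qed
  have \<nu>q: "\<nu> (q (p, t)) = \<mu> p" if p: "p \<in> points S" for p t
  proof -
    have z: "(p, t) \<in> points C" using p by (simp add: points_C)
    have "q (inv_into (points C) q (q (p, t))) = q (p, t)"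
      by (rule f_inv_into_f) (use z in blast)
    then obtain k where "inv_into (points C) q (q (p, t)) = deck k (p, t)"
      using q_eq_iff[OF z] by metis
    then show ?thesis using \<mu>F[OF p] by (simp add: \<nu>_def deck_def)
  qed
  have pT: "\<exists>p t. p \<in> points S \<and> y = q (p, t)" if "y \<in> points T" for y
    using that by (auto simp: points_T points_C)
  have sm: "smooth_map S model_manifold (\<lambda>p. \<mu> p A)" if "A \<in> lie_algebra G GM" for A
    using \<mu> that by (simp add: moment_map_def smooth_equivariant_to_dual_def)
  have smooth: "smooth_map T model_manifold (\<lambda>y. \<nu> y A)" if A: "A \<in> lie_algebra G GM" for A
    unfolding smooth_map_def
  proof (intro conjI ballI)
    have "continuous_map (mtop S) euclideanreal (\<lambda>p. \<mu> p A)"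
      using sm[OF A] by (simp add: smooth_map_def model_manifold_def)
    then have "continuous_map (mtop C) euclideanreal ((\<lambda>p. \<mu> p A) \<circ> fst)"
      by (intro continuous_map_compose[where X' = "mtop S"])
         (auto simp: cylinder_def prod_manifold_def continuous_map_fst)
    then have "continuous_map (mtop C) euclideanreal ((\<lambda>y. \<nu> y A) \<circ> q)"
      by (rule continuous_map_eq) (auto simp: points_C \<nu>q)
    then show "continuous_map (mtop T) (mtop model_manifold) (\<lambda>y. \<nu> y A)"
      unfolding T_eq by (simp add: model_manifold_def tor.continuous_map_quotientI)
  next
    fix d e assume d: "d \<in> atlas T" and "e \<in> atlas (model_manifold :: (real, real) manifold)"
    then have e: "e = (UNIV, id)" by (simp add: model_manifold_def)
    obtain c W where c: "c \<in> atlas C" and W: "openin (mtop C) W" "W \<subseteq> fst c" "inj_on q W"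
      and d: "d = tor.sheet_chart c W"
      using d by (auto simp: T_eq quotient_manifold_def tor.sheet_chart_def)
    obtain b where b: "b \<in> atlas S" and cb: "c = prod_chart b (UNIV, id)"
      using c by (auto simp: cylinder_def prod_manifold_def model_manifold_def prod_chart_def)
    have ib: "inj_on (snd b) (fst b)" using S b by (simp add: differentiable_atlas_def)
    have ic: "inj_on (snd c) (fst c)" and oW: "open (snd c ` W)"
      using C_atlas c W by (auto simp: differentiable_atlas_def)
    have WC: "W \<subseteq> points C" using W(1) by (rule openin_subset)
    \<comment> \<open>a sheet has the same coordinates in the torus as in the cylinder\<close>
    have dom: "snd d ` {y \<in> fst d. \<nu> y A \<in> fst e} = snd c ` W"
    proof -
      have "snd d ` fst d = (\<lambda>z. snd d (q z)) ` W" by (simp add: d tor.sheet_chart_def image_image)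
      also have "\<dots> = snd c ` W"
        by (rule image_cong) (simp_all add: d tor.sheet_chart_value[OF W(3)])
      finally show ?thesis by (simp add: e)
    qed
    show "smooth_on (snd d ` {y \<in> fst d. \<nu> y A \<in> fst e}) (snd e \<circ> (\<lambda>y. \<nu> y A) \<circ> chart_inv d)"
      unfolding dom smooth_on_def
    proof
      fix k
      let ?m = "(\<lambda>p. \<mu> p A) \<circ> chart_inv b"
      have "smooth_on (snd b ` fst b) ?m"
        using sm[OF A] b by (simp add: smooth_map_def model_manifold_def)
      then have "Ck_on k ?m (snd b ` fst b)" by (simp add: smooth_on_def)
      then have "Ck_on k (?m \<circ> fst) (snd c ` W)"
        by (rule Ck_on_comp_fst[OF _ oW]) (use W(2) in \<open>auto simp: cb prod_chart_def\<close>)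
      then show "Ck_on k (snd e \<circ> (\<lambda>y. \<nu> y A) \<circ> chart_inv d) (snd c ` W)"
      proof (rule Ck_on_cong[OF oW, rotated])
        fix a assume "a \<in> snd c ` W"
        then obtain z where z: "z \<in> W" "a = snd c z" by blast
        have zS: "fst z \<in> points S" using z(1) WC by (auto simp: points_C)
        have "fst z \<in> fst b" using z(1) W(2) by (auto simp: cb prod_chart_def)
        then have "(?m \<circ> fst) a = \<mu> (fst z) A"
          using chart_inv_inverse[OF ib] z(2) by (simp add: cb prod_chart_def map_prod_def split_beta)
        moreover have "chart_inv d a = q z"
          using tor.chart_inv_sheet_chart[OF ic W(2,3) z(1)] z(2) d by simp
        ultimately show "(?m \<circ> fst) a = (snd e \<circ> (\<lambda>y. \<nu> y A) \<circ> chart_inv d) a"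
          using \<nu>q[OF zS, of "snd z"] e by simp
      qed
    qed
  qed
  have equi: "smooth_equivariant_to_dual G GM T act \<nu>"
    unfolding smooth_equivariant_to_dual_def
  proof (intro conjI ballI)
    fix y assume "y \<in> points T"
    then obtain p t where p: "p \<in> points S" "y = q (p, t)" using pT by blast
    show "\<nu> y \<in> lie_algebra_dual G GM"
      using \<mu> p \<nu>q by (simp add: moment_map_def smooth_equivariant_to_dual_def)
  next
    fix g y assume g: "g \<in> carrier G" and "y \<in> points T"
    then obtain p t where p: "p \<in> points S" "y = q (p, t)" using pT by blast
    show "\<nu> (act g y) = coadj G GM g (\<nu> y)"
      using \<mu> p \<nu>q g torus_action_q[OF g p(1)] action_in_points[OF g p(1)]
      by (simp add: moment_map_def smooth_equivariant_to_dual_def)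
  qed (rule smooth)
  have "(\<forall>v\<in>tangent_space T y. \<omega> y (induced_field G GM T act A y) v =
           dfun T (\<lambda>y. \<nu> y A) y v - dfun T (\<lambda>y. \<nu> y A) y (reeb_field T \<eta> \<omega> y) * \<eta> y v) \<and>
        \<eta> y (induced_field G GM T act A y) = 0 \<and>
        dfun T (\<lambda>y. \<nu> y A) y (reeb_field T \<eta> \<omega> y) = 0"
    if A: "A \<in> lie_algebra G GM" and y: "y \<in> points T" for A y
  proof -
    obtain p t where p: "p \<in> points S" and yq: "y = q (p, t)" using pT[OF y] by blast
    have z: "(p, t) \<in> points C" using p by (simp add: points_C)
    have dT: "differentiable_fun T (\<lambda>y. \<nu> y A) (q (p, t))"
      using y yq by (intro differentiable_map_model_manifold smooth_map_imp_differentiable_map[OF T_atlas smooth[OF A]]) simp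
    have dS: "differentiable_fun S (\<lambda>p. \<mu> p A) (fst (p, t))"
      using p by (intro differentiable_map_model_manifold smooth_map_imp_differentiable_map[OF S sm[OF A]]) simp
    have reeb: "dfun T (\<lambda>y. \<nu> y A) y (reeb_field T \<eta> \<omega> y) = 0"
      unfolding yq dfun_reeb(2)[OF p dT] by (simp add: \<nu>q[OF p])
    note c = dfun_comp[OF C_atlas S fst_differentiable[OF z] dS]
    have "dfun C ((\<lambda>y. \<nu> y A) \<circ> q) (p, t) = dfun C ((\<lambda>p. \<mu> p A) \<circ> fst) (p, t)"
      by (rule differentiable_fun_cong(2)[OF C_atlas c(1) openin_topspace z]) (auto simp: points_C \<nu>q)
    then have dq: "dfun T (\<lambda>y. \<nu> y A) (q (p, t)) (tangent_map C T q (p, t) w) =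
        dfun S (\<lambda>p. \<mu> p A) p (tangent_map C S fst (p, t) w)" for w
      using c(2)[of w] dfun_comp(2)[OF C_atlas T_atlas q_differentiable[OF z] dT, of w] by simp
    have "\<omega> y (induced_field G GM T act A y) v = dfun T (\<lambda>y. \<nu> y A) y v"
      if "v \<in> tangent_space T y" for v
    proof -
      obtain w where w: "w \<in> tangent_space C (p, t)" "v = tangent_map C T q (p, t) w"
        using tor.tangent_map_q_surj[OF z] \<open>v \<in> tangent_space T y\<close> unfolding yq T_eq by metis
      have "dfun S (\<lambda>p. \<mu> p A) p (tangent_map C S fst (p, t) w) =
          \<Omega> p (induced_field G GM S \<phi> A p) (tangent_map C S fst (p, t) w)"
        using \<mu> A p fst_tangent[OF z, of w] by (simp add: moment_map_def)
      then show ?thesis unfolding yq w(2) omega_induced_field[OF p w(1)] dq by simp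
    qed
    then show ?thesis using reeb eta_induced_field[OF p] yq by simp
  qed
  then show ?thesis using equi by (simp add: cosymplectic_moment_map_def)
qed

end

theorem proposition6p1:
  fixes G :: "('g, 'm) monoid_scheme"
    and GM :: "('g, 'l::real_normed_vector) manifold"
    and S :: "('a, 'e::real_normed_vector) manifold"
    and h :: "('a, 'e) two_tensor"
    and J :: "('a, 'e) endo_field"
    and \<phi> :: "'g \<Rightarrow> 'a \<Rightarrow> 'a"
    and f :: "'a \<Rightarrow> 'a"
    and \<mu> :: "'a \<Rightarrow> ('g, 'l) tvec \<Rightarrow> real"
  assumes "kaehler_manifold S h J"
    and "connected_space (mtop S)" and "points S \<noteq> {}"
    and "lie_group G GM"
    and "smooth_action G GM S \<phi>"
    and "free_action G S \<phi>"
    and "proper_action GM S \<phi>"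
    and "\<And>g. g \<in> carrier G \<Longrightarrow> hermitian_isometry S h J (\<phi> g)"
    and "hermitian_isometry S h J f"
    and "\<And>g p. g \<in> carrier G \<Longrightarrow> p \<in> points S \<Longrightarrow> f (\<phi> g p) = \<phi> g (f p)"
    and "moment_map G GM S \<phi> (fundamental_form h J) \<mu>"
  shows "cosymplectic_hamiltonian G GM (mapping_torus S f) (torus_action S f \<phi>)
           (torus_eta S f) (torus_omega S f (fundamental_form h J))
         \<longleftrightarrow> (\<exists>p\<in>points S. \<mu> (f p) = \<mu> p)"
proof -
  let ?\<Omega> = "fundamental_form h J"
  have sm: "smooth_manifold S" and hm: "riemannian_metric S h" and J: "almost_complex S J"
    using assms(1) by (auto simp: kaehler_manifold_def complex_structure_def)
  note S = smooth_manifold_differentiable_atlas[OF sm]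
  have sGM: "smooth_manifold GM" and pGM: "points GM = carrier G" and gr: "group G"
    using assms(4) by (auto simp: lie_group_def)
  note GM = smooth_manifold_differentiable_atlas[OF sGM]
  have ga: "group_action G (points S) \<phi>" and sa: "smooth_map (prod_manifold GM S) S (\<lambda>(g, p). \<phi> g p)"
    using assms(5) by (auto simp: smooth_action_def)
  have one: "\<one>\<^bsub>G\<^esub> \<in> carrier G" using gr by (simp add: group.is_monoid monoid.one_closed)
  have \<phi>1: "\<phi> \<one>\<^bsub>G\<^esub> p = p" if "p \<in> points S" for p
    using group_action.id_eq_one[OF ga] that by (metis restrict_apply')
  have Jt: "J p u \<in> tangent_space S p" and JJ: "J p (J p u) = (\<lambda>c. - u c)"
    if "p \<in> points S" "u \<in> tangent_space S p" for p u
    using J that by (auto simp: almost_complex_def)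
  have hlin: "h p (lincomb r u s v) w = r * h p u w + s * h p v w"
    if "p \<in> points S" "u \<in> tangent_space S p" "v \<in> tangent_space S p" "w \<in> tangent_space S p"
    for p u v w r s
    using hm that unfolding riemannian_metric_def by blast
  have hsym: "h p u v = h p v u" if "p \<in> points S" "u \<in> tangent_space S p" "v \<in> tangent_space S p" for p u v
    using hm that unfolding riemannian_metric_def by blast
  have hpos: "h p u u > 0" if "p \<in> points S" "u \<in> tangent_space S p" "u \<noteq> (\<lambda>_. 0)" for p u
    using hm that unfolding riemannian_metric_def by blast
  have diffeo: "diffeomorphism S S f" using assms(9) by (simp add: hermitian_isometry_def)
  have fT: "tangent_map S S f p u \<in> tangent_space S (f p)" if "p \<in> points S" for p u
    using diffeo that smooth_map_imp_differentiable_map[OF S]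
    by (intro tangent_map_in_tangent_space[OF S S]) (auto simp: diffeomorphism_def)
  \<comment> \<open>nondegeneracy holds because \<open>\<Omega>(u, J u) = - h(u, u)\<close>; orbit maps are slices of the smooth action\<close>
  interpret mapping_torus_action S f ?\<Omega> G GM \<phi>
  proof (unfold_locales, goal_cases)
    case 1
    show ?case by (rule S)
  next
    case 2
    show ?case by (rule diffeo)
  next
    case (3 p u v)
    then have "J (f p) (tangent_map S S f p v) = tangent_map S S f p (J p v)"
      using assms(9) by (simp add: hermitian_isometry_def)
    moreover have "h (f p) (tangent_map S S f p u) (tangent_map S S f p (J p v)) = h p u (J p v)"
      using assms(9) 3 Jt[OF 3(1,3)] unfolding hermitian_isometry_def pullback2_def by blast
    ultimately show ?case by (simp add: fundamental_form_def)
  next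
    case (4 p v)
    have "lincomb 0 v 0 v = (\<lambda>_. 0)" by (simp add: lincomb_def)
    then show ?case
      using hlin[OF 4(1) 4(2) 4(2) Jt[OF 4], of 0 0] by (simp add: fundamental_form_def)
  next
    case (5 p u)
    have Ju: "J p u \<in> tangent_space S p" and JJu: "J p (J p u) \<in> tangent_space S p"
      using Jt 5(1,2) by blast+
    have "lincomb (- 1) u 0 u = J p (J p u)" by (simp add: lincomb_def JJ[OF 5(1,2)])
    then have "h p (J p (J p u)) u = - h p u u"
      using hlin[OF 5(1,2,2,2), of "- 1" 0] by simp
    moreover have "h p u (J p (J p u)) = 0"
      using 5(3)[OF Ju] by (simp add: fundamental_form_def)
    ultimately have "h p u u = 0" using hsym[OF 5(1,2) JJu] by simp
    then show ?case using hpos[OF 5(1,2)] by force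
  next
    case 6
    show ?case by (rule GM)
  next
    case 7
    show ?case by (rule pGM)
  next
    case 8
    show ?case by (rule one)
  next
    case (9 g p)
    then show ?case using group_action.element_image[OF ga] by blast
  next
    case (10 p)
    have z: "\<one>\<^bsub>G\<^esub> \<in> points GM" using one pGM by simp
    have zp: "(\<one>\<^bsub>G\<^esub>, p) \<in> points (prod_manifold GM S)" using z 10 by (simp add: points_prod_manifold)
    note P = differentiable_atlas_prod[OF GM S]
    have "differentiable_map GM S ((\<lambda>(g, p). \<phi> g p) \<circ> (\<lambda>g. (g, p))) \<one>\<^bsub>G\<^esub>"
      by (rule tangent_map_comp(1)[OF GM P tangent_map_prod_slice(1)[OF GM S z 10]
            smooth_map_imp_differentiable_map[OF P sa zp]])
    then show ?case by (simp add: comp_def)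
  next
    case (11 p)
    then show ?case by (rule \<phi>1)
  next
    case (12 g p)
    then show ?case by (rule assms(10))
  qed
  have mu_smooth: "smooth_map S model_manifold (\<lambda>x. \<mu> x A)" if "A \<in> lie_algebra G GM" for A
    using assms(11) that by (simp add: moment_map_def smooth_equivariant_to_dual_def)
  have mu_diff: "differentiable_fun S (\<lambda>x. \<mu> x A) p" if "A \<in> lie_algebra G GM" "p \<in> points S" for A p
    by (rule differentiable_map_model_manifold[OF smooth_map_imp_differentiable_map[OF S mu_smooth]])
       (use that in simp_all)
  have mu_d: "dfun S (\<lambda>x. \<mu> x A) p v = ?\<Omega> p (induced_field G GM S \<phi> A p) v"
    if "A \<in> lie_algebra G GM" "p \<in> points S" "v \<in> tangent_space S p" for A p v
    using assms(11) that by (simp add: moment_map_def)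
  have mu_eqI: "\<mu> p = \<mu> r"
    if "p \<in> points S" "r \<in> points S" "\<And>A. A \<in> lie_algebra G GM \<Longrightarrow> \<mu> p A = \<mu> r A" for p r
  proof (rule extensionalityI[of _ "lie_algebra G GM"])
    show "\<mu> p \<in> extensional (lie_algebra G GM)" "\<mu> r \<in> extensional (lie_algebra G GM)"
      using assms(11) that(1,2)
      by (auto simp: moment_map_def smooth_equivariant_to_dual_def lie_algebra_dual_def)
  qed (rule that(3))
  show ?thesis
  proof
    assume "cosymplectic_hamiltonian G GM T act \<eta> \<omega>"
    then obtain \<nu> where \<nu>: "cosymplectic_moment_map G GM T act \<eta> \<omega> \<nu>"
      by (auto simp: cosymplectic_hamiltonian_def)
    obtain p where p: "p \<in> points S" using assms(3) by blast
    note fp = f_in_points[OF p]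
    have "\<mu> (f p) = \<mu> p"
    proof (rule mu_eqI[OF fp p])
      fix A assume A: "A \<in> lie_algebra G GM"
      \<comment> \<open>both functions satisfy the moment map equation on \<open>S\<close>\<close>
      have "\<nu> (q (p, 0)) A - \<mu> p A = \<nu> (q (f p, 0)) A - \<mu> (f p) A"
        by (rule equal_dfun_imp_constant_difference[OF sm assms(2)
              moment_map_horizontal_derivative(1)[OF \<nu> A] mu_diff[OF A] _ p fp])
           (simp_all add: moment_map_horizontal_derivative(2)[OF \<nu> A] mu_d[OF A])
      \<comment> \<open>the identification that defines the mapping torus\<close>
      moreover have "q (p, 0) = q (f p, 1)"
        using q_eq_iff[of "(p, 0)"] F_Suc[OF p, of 0] p
        by (auto simp: points_C deck_def F_0 intro: exI[of _ 1])
      moreover have "\<nu> (q (f p, 1)) A = \<nu> (q (f p, 0)) A"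
        by (rule moment_map_constant_vertically[OF \<nu> A fp])
      ultimately show "\<mu> (f p) A = \<mu> p A" by simp
    qed
    then show "\<exists>p\<in>points S. \<mu> (f p) = \<mu> p" using p by blast
  next
    assume "\<exists>p\<in>points S. \<mu> (f p) = \<mu> p"
    then obtain r where r: "r \<in> points S" "\<mu> (f r) = \<mu> r" by blast
    \<comment> \<open>\<open>\<mu>\<^sup>A \<circ> f\<close> and \<open>\<mu>\<^sup>A\<close> have the same differential, since \<open>f\<close> preserves \<open>\<Omega>\<close> and the induced fields\<close>
    have "\<mu> (f p) = \<mu> p" if p: "p \<in> points S" for p
    proof (rule mu_eqI[OF f_in_points[OF p] p])
      fix A assume A: "A \<in> lie_algebra G GM"
      have fd: "differentiable_fun S ((\<lambda>x. \<mu> x A) \<circ> f) x"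
          "dfun S ((\<lambda>x. \<mu> x A) \<circ> f) x v = dfun S (\<lambda>x. \<mu> x A) (f x) (tangent_map S S f x v)"
        if "x \<in> points S" for x v
        using dfun_comp[OF S S f_differentiable[OF that] mu_diff[OF A f_in_points[OF that]]] by blast+
      have field: "induced_field G GM S \<phi> A (f x) = tangent_map S S f x (induced_field G GM S \<phi> A x)"
        if x: "x \<in> points S" for x
      proof -
        have d: "differentiable_map S S f (\<phi> \<one>\<^bsub>G\<^esub> x)" using f_differentiable[OF x] \<phi>1[OF x] by simp
        note c = tangent_map_comp[OF GM S orbit_differentiable[OF x] d]
        have "tangent_map GM S (\<lambda>g. \<phi> g (f x)) \<one>\<^bsub>G\<^esub> = tangent_map GM S (f \<circ> (\<lambda>g. \<phi> g x)) \<one>\<^bsub>G\<^esub>"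
          by (rule differentiable_map_cong(2)[OF GM c(1) openin_topspace])
             (use one x in \<open>simp_all add: pGM commute\<close>)
        then show ?thesis using c(2) \<phi>1[OF x] by (simp add: induced_field_def)
      qed
      have "((\<lambda>x. \<mu> x A) \<circ> f) p - \<mu> p A = ((\<lambda>x. \<mu> x A) \<circ> f) r - \<mu> r A"
      proof (rule equal_dfun_imp_constant_difference[OF sm assms(2) fd(1) mu_diff[OF A] _ p r(1)])
        fix x v assume x: "x \<in> points S" and v: "v \<in> tangent_space S x"
        have "dfun S ((\<lambda>x. \<mu> x A) \<circ> f) x v =
            ?\<Omega> (f x) (tangent_map S S f x (induced_field G GM S \<phi> A x)) (tangent_map S S f x v)"
          unfolding fd(2)[OF x] mu_d[OF A f_in_points[OF x] fT[OF x]] field[OF x] ..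
        also have "\<dots> = ?\<Omega> x (induced_field G GM S \<phi> A x) v"
          by (rule invariant[OF x induced_field_in_tangent_space[OF x] v])
        finally show "dfun S ((\<lambda>x. \<mu> x A) \<circ> f) x v = dfun S (\<lambda>x. \<mu> x A) x v"
          using mu_d[OF A x v] by simp
      qed
      then show "\<mu> (f p) A = \<mu> p A" using r(2) by simp
    qed
    from cosymplectic_moment_map_of_invariant[OF assms(11) this]
    show "cosymplectic_hamiltonian G GM T act \<eta> \<omega>"
      unfolding cosymplectic_hamiltonian_def by blast
  qed
qed

end
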